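(* Let $A\in 2^\omega$. If $A$ is low for $1$-randomness, then $A$ is low for weak $2$-random tests.
   Context: Subsets of $\omega$ are identified with elements of $2^\omega$; $\mu$ is Lebesgue (fair-coin) measure on $2^\omega$. For an oracle $A$, a Martin-Löf test relative to $A$ is an $A$-computable (i.e. uniformly $\Sigma^A_1$) nested sequence of $\Sigma^A_1$ classes $U^A_0\supseteq U^A_1\supseteq\cdots$ in $2^\omega$ with $\mu(U^A_n)\leq 2^{-n}$. A set $R$ is $A$-random (or $1$-random relative to $A$) if $R\notin\bigcap_n U^A_n$ for every such test; $1$-random means $\emptyset$-random. $A$ is low for $1$-randomness if every $1$-random set is $A$-random. A generalized Martin-Löf test relative to $A$ is an $A$-computable (uniformly $\Sigma^A_1$) nested sequence of $\Sigma^A_1$ classes $U_0\supseteq U_1\supseteq\cdots$ with $\mu(\bigcap_i U_i)=0$; a generalized Martin-Löf test (unrelativized) is the case $A=\emptyset$. $A$ is low for weak $2$-random tests if for every generalized Martin-Löf test $\{V^A_i\}_{i\in\omega}$ relative to $A$ there is an (unrelativized) generalized Martin-Löf test $\{U_i\}_{i\in\omega}$ such that $\bigcap_i V^A_i\subseteq\bigcap_i U_i$. *)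

theory Defs
  imports "HOL-Probability.Probability" "HOL-Library.Nat_Bijection"
begin

text \<open>Partial recursive functions relative to an oracle, as in Kleene's definition, but with unary
  functions only: several arguments are passed through the Cantor pairing \<^const>\<open>prod_encode\<close>.\<close>

datatype oprog =
    OZero
  | OSucc
  | OFst
  | OSnd
  | OQuery
  | OPair oprog oprog
  | OComp oprog oprog
  | ORec oprog oprog
  | OMu oprog

text \<open>\<open>computes A p x y\<close>: with oracle \<open>A\<close> and input \<open>x\<close>, the program \<open>p\<close> converges with output \<open>y\<close>.
  \<open>ORec\<close> is primitive recursion on the second component of the argument. \<open>OMu\<close> is unbounded search
  for a zero; it requires convergence at all smaller values.\<close>

inductive computes :: "(nat \<Rightarrow> bool) \<Rightarrow> oprog \<Rightarrow> nat \<Rightarrow> nat \<Rightarrow> bool" for A :: "nat \<Rightarrow> bool" where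
  zero: "computes A OZero x 0"
| succ: "computes A OSucc x (Suc x)"
| proj1: "computes A OFst (prod_encode (a, b)) a"
| proj2: "computes A OSnd (prod_encode (a, b)) b"
| query: "computes A OQuery x (of_bool (A x))"
| pair: "computes A p x y \<Longrightarrow> computes A q x z \<Longrightarrow> computes A (OPair p q) x (prod_encode (y, z))"
| comp: "computes A q x y \<Longrightarrow> computes A p y z \<Longrightarrow> computes A (OComp p q) x z"
| rec_0: "computes A p a y \<Longrightarrow> computes A (ORec p q) (prod_encode (a, 0)) y"
| rec_Suc: "computes A (ORec p q) (prod_encode (a, n)) r \<Longrightarrow>
    computes A q (prod_encode (a, prod_encode (n, r))) y \<Longrightarrow>
    computes A (ORec p q) (prod_encode (a, Suc n)) y"
| mu: "computes A p (prod_encode (a, n)) 0 \<Longrightarrow>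
    (\<And>m. m < n \<Longrightarrow> \<exists>y. computes A p (prod_encode (a, m)) (Suc y)) \<Longrightarrow>
    computes A (OMu p) a n"

definition ce_in :: "(nat \<Rightarrow> bool) \<Rightarrow> nat set \<Rightarrow> bool" where
  "ce_in A W \<longleftrightarrow> (\<exists>p. W = {x. \<exists>y. computes A p x y})"

definition string_code :: "bool list \<Rightarrow> nat" where
  "string_code \<sigma> = list_encode (map of_bool \<sigma>)"

definition cylinder :: "bool list \<Rightarrow> (nat \<Rightarrow> bool) set" where
  "cylinder \<sigma> = {X. \<forall>i < length \<sigma>. X i = \<sigma> ! i}"

text \<open>A sequence of classes is uniformly \<open>\<Sigma>\<^sub>1\<close> in \<open>A\<close> if a single set of pairs (index, string)
  that is c.e. in \<open>A\<close> gives, for each index, strings whose cylinders have union \<open>U n\<close>.\<close>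

definition unif_sigma1 :: "(nat \<Rightarrow> bool) \<Rightarrow> (nat \<Rightarrow> (nat \<Rightarrow> bool) set) \<Rightarrow> bool" where
  "unif_sigma1 A U \<longleftrightarrow>
    (\<exists>W. ce_in A W \<and>
      (\<forall>n. U n = (\<Union>\<sigma> \<in> {\<sigma>. prod_encode (n, string_code \<sigma>) \<in> W}. cylinder \<sigma>)))"

definition cantor_measure :: "(nat \<Rightarrow> bool) measure" where
  "cantor_measure = PiM UNIV (\<lambda>_. measure_pmf (bernoulli_pmf (1/2)))"

definition ml_test :: "(nat \<Rightarrow> bool) \<Rightarrow> (nat \<Rightarrow> (nat \<Rightarrow> bool) set) \<Rightarrow> bool" where
  "ml_test A U \<longleftrightarrow> unif_sigma1 A U \<and> (\<forall>n. U (Suc n) \<subseteq> U n) \<and>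
    (\<forall>n. emeasure cantor_measure (U n) \<le> ennreal ((1/2) ^ n))"

definition gen_ml_test :: "(nat \<Rightarrow> bool) \<Rightarrow> (nat \<Rightarrow> (nat \<Rightarrow> bool) set) \<Rightarrow> bool" where
  "gen_ml_test A U \<longleftrightarrow> unif_sigma1 A U \<and> (\<forall>n. U (Suc n) \<subseteq> U n) \<and>
    emeasure cantor_measure (\<Inter>n. U n) = 0"

abbreviation empty_oracle :: "nat \<Rightarrow> bool" where
  "empty_oracle \<equiv> (\<lambda>_. False)"

definition random_rel :: "(nat \<Rightarrow> bool) \<Rightarrow> (nat \<Rightarrow> bool) \<Rightarrow> bool" where
  "random_rel A R \<longleftrightarrow> (\<forall>U. ml_test A U \<longrightarrow> R \<notin> (\<Inter>n. U n))"

definition low_for_1_randomness :: "(nat \<Rightarrow> bool) \<Rightarrow> bool" where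
  "low_for_1_randomness A \<longleftrightarrow> (\<forall>R. random_rel empty_oracle R \<longrightarrow> random_rel A R)"

definition low_for_weak_2_random_tests :: "(nat \<Rightarrow> bool) \<Rightarrow> bool" where
  "low_for_weak_2_random_tests A \<longleftrightarrow>
    (\<forall>V. gen_ml_test A V \<longrightarrow>
      (\<exists>U. gen_ml_test empty_oracle U \<and> (\<Inter>i. V i) \<subseteq> (\<Inter>i. U i)))"

end

(* If A is low for 1-randomness, W is c.e. in A and the weights 2^-f(w) of its elements (f computable)
   have finite sum, then W has a c.e. superset T of finite weight: the independent events "X vanishes
   on the w-th block of f(w) + k coordinates", w in W, form an A-test, and if no c.e. open set of
   measure below 1 covered a level of it up to measure zero, a forcing construction would yield a
   1-random set that fails the test.

   Applied to the initial segments of an A-decidable set B, weighted by a universal bounded c.e. set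
   of requests, this traces B through a tree of bounded width, as in Chaitin's counting
   argument for sets of minimal initial segment complexity; hence B is the intersection of a
   decreasing sequence of uniformly c.e. sets D_m.

   For the theorem, let B be the A-decidable set of the minimal strings enumerated into the V_i. Cover
   B by a c.e. set T of finite weight and replace V_i by the open sets generated by the strings in the
   intersection of T with D_m. A point of all of these lies in V_i, or in infinitely many cylinders
   from T, which has probability 0 by the Borel-Cantelli lemma. *)
theory Submission
  imports Defs
begin

text \<open>The two consequences of lowness complement each other. The sets D_m reject every wrong
  string, but a point may pass each D_m through a different string. The finite weight of the cover
  leaves almost every point only finitely many candidate strings per index, and then one of them
  lies in all D_m. The counting argument uses discrete weights in place of prefix complexity: the
  sum over e of 2^-(e+1) times the weight that the e-th request set gives to n stands for 2^-K(n).
  The cover of the requests, labelled with prefixes of B, is itself turned into one of these request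
  sets, say the d-th, with a loss 2^-c. If s strings of length n are attached to every request for
  n, then s 2^-(d+1+c) times the weight at n is at most the weight at n again, which bounds s
  independently of n. The passage from bounded width to a decreasing sequence is not uniform: it
  uses finite information, one level of the tree and the prefix of B there.\<close>

inductive_cases computes_zeroE: "computes A OZero x y"
inductive_cases computes_succE: "computes A OSucc x y"
inductive_cases computes_fstE: "computes A OFst x y"
inductive_cases computes_sndE: "computes A OSnd x y"
inductive_cases computes_queryE: "computes A OQuery x y"
inductive_cases computes_pairE: "computes A (OPair p q) x y"
inductive_cases computes_compE: "computes A (OComp p q) x y"
inductive_cases computes_recE: "computes A (ORec p q) x y"
inductive_cases computes_muE: "computes A (OMu p) x y"

lemma computes_deterministic:
  assumes "computes A p x y" "computes A p x z"
  shows "y = z"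
  using assms
proof (induction arbitrary: z rule: computes.induct)
  case (pair p x y q z)
  from pair.prems show ?case by (rule computes_pairE) (use pair.IH in auto)
next
  case (comp q x y p z)
  from comp.prems show ?case by (rule computes_compE) (use comp.IH in auto)
next
  case (rec_0 p a y q)
  from rec_0.prems show ?case by (rule computes_recE) (use rec_0.IH in auto)
next
  case (rec_Suc p q a n r y)
  from rec_Suc.prems show ?case
  proof (rule computes_recE)
    fix a' n' r'
    assume *: "prod_encode (a, Suc n) = prod_encode (a', Suc n')"
      "computes A (ORec p q) (prod_encode (a', n')) r'"
      "computes A q (prod_encode (a', prod_encode (n', r'))) z"
    then have "r = r'" using rec_Suc.IH(1) by simp
    then show "y = z" using * rec_Suc.IH(2) by simp
  qed auto
next
  case (mu p a n)
  from mu.prems have z: "computes A p (prod_encode (a, z)) 0"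
    "\<And>m. m < z \<Longrightarrow> \<exists>y. computes A p (prod_encode (a, m)) (Suc y)"
    by (auto elim: computes_muE)
  \<comment> \<open>At a place z below n the search ending in n demands a positive value, while the
    search ending in z demands 0 there; uniqueness of values excludes this, and likewise with n and
    z exchanged.\<close>
  have "\<not> z < n" using mu.IH(2) z(1) by blast
  moreover have "\<not> n < z" using mu.IH(1) z(2) by blast
  ultimately show ?case by simp
qed (auto elim: computes_zeroE computes_succE computes_fstE computes_sndE computes_queryE)

section \<open>Recursive functions and decidable predicates\<close>

definition ppair :: "nat \<Rightarrow> nat \<Rightarrow> nat" where "ppair a b = prod_encode (a, b)"
definition pfst :: "nat \<Rightarrow> nat" where "pfst x = fst (prod_decode x)"
definition psnd :: "nat \<Rightarrow> nat" where "psnd x = snd (prod_decode x)"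

lemma pfst_ppair [simp]: "pfst (ppair a b) = a"
  and psnd_ppair [simp]: "psnd (ppair a b) = b"
  and ppair_proj [simp]: "ppair (pfst x) (psnd x) = x"
  and ppair_eq_iff [simp]: "ppair a b = ppair c d \<longleftrightarrow> a = c \<and> b = d"
  by (simp_all add: ppair_def pfst_def psnd_def)

lemma le_ppair: "a \<le> ppair a b" "b \<le> ppair a b"
  by (simp_all add: ppair_def le_prod_encode_1 le_prod_encode_2)

lemma pfst_le: "pfst x \<le> x" and psnd_le: "psnd x \<le> x"
  by (metis le_ppair ppair_proj)+

definition recursive_in :: "(nat \<Rightarrow> bool) \<Rightarrow> (nat \<Rightarrow> nat) \<Rightarrow> bool" where
  "recursive_in A f \<longleftrightarrow> (\<exists>p. \<forall>x. computes A p x (f x))"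

text \<open>A predicate of several arguments is treated as a predicate of the coded tuple \<open>z\<close>, as in
  \<open>\<lambda>z. P (pfst z) (psnd z)\<close>.\<close>

definition decidable_in :: "(nat \<Rightarrow> bool) \<Rightarrow> (nat \<Rightarrow> bool) \<Rightarrow> bool" where
  "decidable_in A P \<longleftrightarrow> recursive_in A (\<lambda>x. of_bool (P x))"

named_theorems recursive_intros

lemma recursive_in_comp:
  assumes "recursive_in A f" "recursive_in A g"
  shows "recursive_in A (\<lambda>x. f (g x))"
  using assms unfolding recursive_in_def by (meson computes.comp)

lemma recursive_in_id [recursive_intros]: "recursive_in A (\<lambda>x. x)"
  unfolding recursive_in_def
proof (intro exI allI)
  fix x show "computes A (OPair OFst OSnd) x x"
    by (metis computes.pair computes.proj1 computes.proj2 prod_decode_inverse surj_pair)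
qed

lemma recursive_in_const [recursive_intros]: "recursive_in A (\<lambda>x. c)"
proof (induction c)
  case 0 then show ?case unfolding recursive_in_def by (metis computes.zero)
next
  case (Suc c) then show ?case
    unfolding recursive_in_def by (meson computes.comp computes.succ)
qed

lemma recursive_in_Suc [recursive_intros]: "recursive_in A f \<Longrightarrow> recursive_in A (\<lambda>x. Suc (f x))"
  unfolding recursive_in_def by (meson computes.comp computes.succ)

lemma recursive_in_pfst [recursive_intros]: "recursive_in A f \<Longrightarrow> recursive_in A (\<lambda>x. pfst (f x))"
proof -
  have "recursive_in A pfst"
    unfolding recursive_in_def by (metis computes.proj1 ppair_def ppair_proj)
  then show "recursive_in A f \<Longrightarrow> recursive_in A (\<lambda>x. pfst (f x))" by (rule recursive_in_comp)
qed

lemma recursive_in_psnd [recursive_intros]: "recursive_in A f \<Longrightarrow> recursive_in A (\<lambda>x. psnd (f x))"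
proof -
  have "recursive_in A psnd"
    unfolding recursive_in_def by (metis computes.proj2 ppair_def ppair_proj)
  then show "recursive_in A f \<Longrightarrow> recursive_in A (\<lambda>x. psnd (f x))" by (rule recursive_in_comp)
qed

lemma recursive_in_ppair [recursive_intros]:
  "recursive_in A f \<Longrightarrow> recursive_in A g \<Longrightarrow> recursive_in A (\<lambda>x. ppair (f x) (g x))"
  unfolding recursive_in_def ppair_def by (meson computes.pair)

text \<open>Functions of several arguments are recursive only as functions of the coded tuple; this
  and the three-place version supply them with arbitrary recursive arguments.\<close>

lemma recursive_in_comp2:
  assumes "recursive_in A (\<lambda>z. F (pfst z) (psnd z))" "recursive_in A f" "recursive_in A g"
  shows "recursive_in A (\<lambda>x. F (f x) (g x))"
  using recursive_in_comp[OF assms(1) recursive_in_ppair[OF assms(2,3)]] by simp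

lemma recursive_in_comp3:
  assumes "recursive_in A (\<lambda>z. F (pfst z) (pfst (psnd z)) (psnd (psnd z)))" "recursive_in A f" "recursive_in A g" "recursive_in A h"
  shows "recursive_in A (\<lambda>x. F (f x) (g x) (h x))"
  using recursive_in_comp[OF assms(1) recursive_in_ppair[OF assms(2) recursive_in_ppair[OF assms(3,4)]]] by simp

text \<open>The whole input x is kept as the parameter of \<open>ORec\<close>, so that the start
  value and the step may depend on it. All arithmetic below is reduced to this scheme.\<close>

lemma recursive_in_rec_nat [recursive_intros]:
  assumes g: "recursive_in A g" and h: "recursive_in A (\<lambda>z. h (pfst z) (pfst (psnd z)) (psnd (psnd z)))"
    and b: "recursive_in A b"
  shows "recursive_in A (\<lambda>x. rec_nat (g x) (h x) (b x))"
proof -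
  obtain p q r where p: "\<And>x. computes A p x (g x)"
    and q: "\<And>x. computes A q x (h (pfst x) (pfst (psnd x)) (psnd (psnd x)))"
    and r: "\<And>x. computes A r x (ppair x (b x))"
    using g h recursive_in_ppair[OF recursive_in_id b] unfolding recursive_in_def by metis
  have *: "computes A (ORec p q) (ppair x n) (rec_nat (g x) (h x) n)" for x n
  proof (induction n)
    case 0 then show ?case using p by (simp add: ppair_def computes.rec_0)
  next
    case (Suc n)
    have "computes A q (ppair x (ppair n (rec_nat (g x) (h x) n))) (rec_nat (g x) (h x) (Suc n))"
      using q[of "ppair x (ppair n (rec_nat (g x) (h x) n))"] by simp
    with Suc show ?case unfolding ppair_def by (rule computes.rec_Suc)
  qed
  have "computes A (OComp (ORec p q) r) x (rec_nat (g x) (h x) (b x))" for x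
    by (rule computes.comp[OF r *])
  then show ?thesis unfolding recursive_in_def by blast
qed

lemma recursive_in_query: "recursive_in A (\<lambda>x. of_bool (A x))"
  unfolding recursive_in_def by (meson computes.query)

lemma recursive_in_add [recursive_intros]:
  assumes "recursive_in A f" "recursive_in A g" shows "recursive_in A (\<lambda>x. f x + g x)"
proof -
  have "a + b = rec_nat a (\<lambda>n r. Suc r) b" for a b :: nat by (induction b) auto
  then show ?thesis by (simp only:) (intro recursive_intros assms)
qed

lemma recursive_in_mult [recursive_intros]:
  assumes "recursive_in A f" "recursive_in A g" shows "recursive_in A (\<lambda>x. f x * g x)"
proof -
  have "a * b = rec_nat 0 (\<lambda>n r. r + a) b" for a b :: nat by (induction b) auto
  then show ?thesis
    by (simp only:) (intro recursive_intros recursive_in_comp[OF assms(1)] assms)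
qed

lemma recursive_in_power [recursive_intros]:
  assumes "recursive_in A f" "recursive_in A g" shows "recursive_in A (\<lambda>x. f x ^ g x)"
proof -
  have "a ^ b = rec_nat 1 (\<lambda>n r. r * a) b" for a b :: nat by (induction b) auto
  then show ?thesis
    by (simp only:) (intro recursive_intros recursive_in_comp[OF assms(1)] assms)
qed

lemma recursive_in_diff [recursive_intros]:
  assumes "recursive_in A f" "recursive_in A g" shows "recursive_in A (\<lambda>x. f x - g x)"
proof -
  \<comment> \<open>The recursion ignores its accumulator and returns the counter, which is the
    predecessor.\<close>
  have pred: "r - 1 = rec_nat 0 (\<lambda>n r. n) r" for r :: nat by (cases r) auto
  have "a - b = rec_nat a (\<lambda>n r. r - 1) b" for a b :: nat by (induction b) auto
  then show ?thesis by (simp only: pred) (intro recursive_intros assms)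
qed

lemma recursive_in_of_bool [recursive_intros]: "decidable_in A P \<Longrightarrow> recursive_in A (\<lambda>x. of_bool (P x))"
  by (simp add: decidable_in_def)

lemma recursive_in_sum [recursive_intros]:
  assumes F: "recursive_in A (\<lambda>z. F (pfst z) (psnd z))" and b: "recursive_in A b"
  shows "recursive_in A (\<lambda>x. \<Sum>i<b x. F x i)"
proof -
  have "(\<Sum>i<n. G i) = rec_nat 0 (\<lambda>i r. r + G i) n" for n and G :: "nat \<Rightarrow> nat"
    by (induction n) auto
  then show ?thesis by (simp only:) (intro recursive_intros recursive_in_comp2[OF F] b)
qed

lemma decidable_in_zero: "recursive_in A f \<Longrightarrow> decidable_in A (\<lambda>x. f x = 0)"
proof -
  assume f: "recursive_in A f"
  have "of_bool (n = 0) = rec_nat (1::nat) (\<lambda>_ _. 0) n" for n by (cases n) auto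
  then show ?thesis unfolding decidable_in_def by (simp only:) (intro recursive_intros f)
qed

lemma decidable_in_not [recursive_intros]:
  assumes "decidable_in A P" shows "decidable_in A (\<lambda>x. \<not> P x)"
  using decidable_in_zero[OF recursive_in_of_bool[OF assms]] by simp

lemma decidable_in_conj [recursive_intros]:
  assumes "decidable_in A P" "decidable_in A Q" shows "decidable_in A (\<lambda>x. P x \<and> Q x)"
  unfolding decidable_in_def of_bool_conj using assms by (intro recursive_intros)

lemma decidable_in_disj [recursive_intros]:
  assumes "decidable_in A P" "decidable_in A Q" shows "decidable_in A (\<lambda>x. P x \<or> Q x)"
proof -
  have "decidable_in A (\<lambda>x. \<not> (\<not> P x \<and> \<not> Q x))" using assms by (intro recursive_intros)
  then show ?thesis by simp
qed

lemma decidable_in_imp [recursive_intros]: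
  assumes "decidable_in A P" "decidable_in A Q" shows "decidable_in A (\<lambda>x. P x \<longrightarrow> Q x)"
  unfolding imp_conv_disj using assms by (intro recursive_intros)

lemma decidable_in_le [recursive_intros]:
  assumes "recursive_in A f" "recursive_in A g" shows "decidable_in A (\<lambda>x. f x \<le> g x)"
proof -
  have "decidable_in A (\<lambda>x. f x - g x = 0)" by (intro decidable_in_zero recursive_intros assms)
  then show ?thesis by simp
qed

lemma decidable_in_less [recursive_intros]:
  assumes "recursive_in A f" "recursive_in A g" shows "decidable_in A (\<lambda>x. f x < g x)"
proof -
  have "decidable_in A (\<lambda>x. \<not> g x \<le> f x)" by (intro recursive_intros assms)
  then show ?thesis by (simp add: not_le)
qed

lemma decidable_in_eq [recursive_intros]:
  assumes "recursive_in A f" "recursive_in A g" shows "decidable_in A (\<lambda>x. f x = g x)"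
proof -
  have "decidable_in A (\<lambda>x. f x \<le> g x \<and> g x \<le> f x)" by (intro recursive_intros assms)
  then show ?thesis by (simp add: order_eq_iff)
qed

lemma decidable_in_const [recursive_intros]: "decidable_in A (\<lambda>x. c)"
  unfolding decidable_in_def by (rule recursive_in_const)

lemma decidable_in_comp: "decidable_in A P \<Longrightarrow> recursive_in A f \<Longrightarrow> decidable_in A (\<lambda>x. P (f x))"
  unfolding decidable_in_def by (rule recursive_in_comp)

lemma decidable_in_comp2:
  assumes "decidable_in A (\<lambda>z. P (pfst z) (psnd z))" "recursive_in A f" "recursive_in A g"
  shows "decidable_in A (\<lambda>x. P (f x) (g x))"
  using assms unfolding decidable_in_def by (rule recursive_in_comp2)

lemma decidable_in_comp3:
  assumes "decidable_in A (\<lambda>z. P (pfst z) (pfst (psnd z)) (psnd (psnd z)))" "recursive_in A f" "recursive_in A g" "recursive_in A h"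
  shows "decidable_in A (\<lambda>x. P (f x) (g x) (h x))"
  using assms unfolding decidable_in_def by (rule recursive_in_comp3)

lemma decidable_in_query: "recursive_in A f \<Longrightarrow> decidable_in A (\<lambda>x. A (f x))"
  by (rule decidable_in_comp) (simp_all add: decidable_in_def recursive_in_query)

lemma decidable_in_ex_less [recursive_intros]:
  assumes P: "decidable_in A (\<lambda>z. P (pfst z) (psnd z))" and b: "recursive_in A b"
  shows "decidable_in A (\<lambda>x. \<exists>i<b x. P x i)"
proof -
  have "decidable_in A (\<lambda>x. 0 < (\<Sum>i<b x. of_bool (P x i) :: nat))" by (intro recursive_intros P b)
  moreover have "0 < (\<Sum>i<n. of_bool (Q i) :: nat) \<longleftrightarrow> (\<exists>i<n. Q i)" for n :: nat and Q
    by (induction n) (auto simp: less_Suc_eq)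
  ultimately show ?thesis by simp
qed

lemma decidable_in_all_less [recursive_intros]:
  assumes P: "decidable_in A (\<lambda>z. P (pfst z) (psnd z))" and b: "recursive_in A b"
  shows "decidable_in A (\<lambda>x. \<forall>i<b x. P x i)"
proof -
  have "decidable_in A (\<lambda>x. \<not> (\<exists>i<b x. \<not> P x i))" by (intro recursive_intros P b)
  then show ?thesis by simp
qed

lemma decidable_in_ex_le [recursive_intros]:
  assumes "decidable_in A (\<lambda>z. P (pfst z) (psnd z))" "recursive_in A b"
  shows "decidable_in A (\<lambda>x. \<exists>i\<le>b x. P x i)"
  using decidable_in_ex_less[OF assms(1) recursive_in_Suc[OF assms(2)]] by (simp add: less_Suc_eq_le)

section \<open>Finite sets of numbers as binary codes\<close>

text \<open>Bit u of S is read off from a decomposition of S with bounded quantifiers, sums,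
  products and powers only, so decidability needs no separate treatment of division.\<close>

lemma mem_set_decode_iff: "u \<in> set_decode S \<longleftrightarrow> (\<exists>q<Suc S. \<exists>r<2 ^ u. S = (2 * q + 1) * 2 ^ u + r)"
proof
  assume "u \<in> set_decode S"
  then have o: "odd (S div 2 ^ u)" by (simp add: set_decode_def)
  then obtain q where q: "S div 2 ^ u = 2 * q + 1" by (elim oddE)
  have "S = (2 * q + 1) * 2 ^ u + S mod 2 ^ u" by (metis q div_mult_mod_eq)
  moreover have "q \<le> S"
    by (metis q div_le_dividend le_add1 le_trans mult_2)
  ultimately show "\<exists>q<Suc S. \<exists>r<2 ^ u. S = (2 * q + 1) * 2 ^ u + r"
    by (intro exI[of _ q] conjI exI[of _ "S mod 2 ^ u"]) auto
next
  assume "\<exists>q<Suc S. \<exists>r<2 ^ u. S = (2 * q + 1) * 2 ^ u + r"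
  then obtain q r where r: "r < 2 ^ u" and S: "S = (2 * q + 1) * 2 ^ u + r" by blast
  have "S div 2 ^ u = 2 * q + 1" unfolding S using r by (subst div_mult_self3) auto
  then show "u \<in> set_decode S" by (simp add: set_decode_def)
qed

lemma decidable_in_set_decode [recursive_intros]:
  assumes "recursive_in A f" "recursive_in A g" shows "decidable_in A (\<lambda>x. f x \<in> set_decode (g x))"
proof (rule decidable_in_comp2[OF _ assms])
  show "decidable_in A (\<lambda>z. pfst z \<in> set_decode (psnd z))"
    unfolding mem_set_decode_iff by (intro recursive_intros)
qed

lemma recursive_in_set_encode [recursive_intros]:
  assumes P: "decidable_in A (\<lambda>z. P (pfst z) (psnd z))" and b: "recursive_in A b"
  shows "recursive_in A (\<lambda>x. set_encode {i. i < b x \<and> P x i})"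
proof -
  have "set_encode {i. i < n \<and> Q i} = (\<Sum>i<n. of_bool (Q i) * 2 ^ i)" for n Q
  proof -
    have "(\<Sum>i<n. of_bool (Q i) * 2 ^ i :: nat) = (\<Sum>i<n. if Q i then 2 ^ i else 0)"
      by (intro sum.cong) auto
    also have "\<dots> = (\<Sum>i \<in> {i \<in> {..<n}. Q i}. 2 ^ i)" by (rule sum.inter_filter[symmetric]) simp
    finally show ?thesis by (simp add: set_encode_def)
  qed
  then show ?thesis by (simp only:) (intro recursive_intros P b)
qed

primrec without_query :: "oprog \<Rightarrow> oprog" where
  "without_query OZero = OZero"
| "without_query OSucc = OSucc"
| "without_query OFst = OFst"
| "without_query OSnd = OSnd"
| "without_query OQuery = OZero"
| "without_query (OPair p q) = OPair (without_query p) (without_query q)"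
| "without_query (OComp p q) = OComp (without_query p) (without_query q)"
| "without_query (ORec p q) = ORec (without_query p) (without_query q)"
| "without_query (OMu p) = OMu (without_query p)"

text \<open>The empty oracle answers every query with 0, as \<open>OZero\<close> does; the changed
  program then gives the same values with any oracle. This makes oracle-free computability a special
  case of computability in A.\<close>

lemma computes_without_query:
  "computes empty_oracle p x y \<Longrightarrow> computes A (without_query p) x y"
proof (induction rule: computes.induct)
  case (mu p a n)
  then show ?case by (simp, intro computes.mu) blast+
qed (auto intro: computes.intros)

lemma recursive_in_empty: "recursive_in empty_oracle f \<Longrightarrow> recursive_in A f"
  unfolding recursive_in_def using computes_without_query by blast

lemma decidable_in_empty: "decidable_in empty_oracle P \<Longrightarrow> decidable_in A P"
  unfolding decidable_in_def by (rule recursive_in_empty)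

section \<open>Sigma-1 predicates and universality\<close>

definition sigma1_in :: "(nat \<Rightarrow> bool) \<Rightarrow> (nat \<Rightarrow> bool) \<Rightarrow> bool" where
  "sigma1_in A P \<longleftrightarrow> (\<exists>R. decidable_in A (\<lambda>z. R (pfst z) (psnd z)) \<and> (\<forall>x. P x \<longleftrightarrow> (\<exists>s. R x s)))"

named_theorems sigma1_intros

lemma sigI:
  assumes "decidable_in A (\<lambda>z. R (pfst z) (psnd z))" "\<And>x. P x \<longleftrightarrow> (\<exists>s. R x s)"
  shows "sigma1_in A P"
  using assms unfolding sigma1_in_def by blast

lemma sigma1_in_decidable: "decidable_in A P \<Longrightarrow> sigma1_in A P"
  by (rule sigI[where R = "\<lambda>x s. P x"]) (simp_all add: decidable_in_comp[OF _ recursive_in_pfst[OF recursive_in_id]])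

lemma sigma1_in_empty: "sigma1_in empty_oracle P \<Longrightarrow> sigma1_in A P"
  unfolding sigma1_in_def using decidable_in_empty by blast

lemma sigma1_in_comp:
  assumes "sigma1_in A P" "recursive_in A f" shows "sigma1_in A (\<lambda>x. P (f x))"
proof -
  obtain R where R: "decidable_in A (\<lambda>z. R (pfst z) (psnd z))" "\<And>x. P x \<longleftrightarrow> (\<exists>s. R x s)"
    using assms unfolding sigma1_in_def by blast
  show ?thesis
  proof (rule sigI[where R = "\<lambda>x s. R (f x) s"])
    show "decidable_in A (\<lambda>z. R (f (pfst z)) (psnd z))"
      by (intro decidable_in_comp2[OF R(1)] recursive_in_comp[OF assms(2)] recursive_intros)
  qed (simp add: R(2))
qed

lemma sigma1_in_comp2:
  assumes "sigma1_in A (\<lambda>z. P (pfst z) (psnd z))" "recursive_in A f" "recursive_in A g"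
  shows "sigma1_in A (\<lambda>x. P (f x) (g x))"
  using sigma1_in_comp[OF assms(1) recursive_in_ppair[OF assms(2,3)]] by simp

lemma sigma1_in_comp3:
  assumes "sigma1_in A (\<lambda>z. P (pfst z) (pfst (psnd z)) (psnd (psnd z)))" "recursive_in A f" "recursive_in A g" "recursive_in A h"
  shows "sigma1_in A (\<lambda>x. P (f x) (g x) (h x))"
  using sigma1_in_comp[OF assms(1) recursive_in_ppair[OF assms(2) recursive_in_ppair[OF assms(3,4)]]] by simp

lemma sigma1_in_ex [sigma1_intros]:
  assumes "sigma1_in A (\<lambda>z. P (pfst z) (psnd z))" shows "sigma1_in A (\<lambda>x. \<exists>i. P x i)"
proof -
  obtain R where R: "decidable_in A (\<lambda>z. R (pfst z) (psnd z))"
      "\<And>z. P (pfst z) (psnd z) \<longleftrightarrow> (\<exists>s. R z s)"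
    using assms unfolding sigma1_in_def by blast
  have *: "P x i \<longleftrightarrow> (\<exists>s. R (ppair x i) s)" for x i using R(2)[of "ppair x i"] by simp
  show ?thesis
  proof (rule sigI[where R = "\<lambda>x s. R (ppair x (pfst s)) (psnd s)"])
    show "decidable_in A (\<lambda>z. R (ppair (pfst z) (pfst (psnd z))) (psnd (psnd z)))"
      by (intro decidable_in_comp2[OF R(1)] recursive_intros)
    fix x show "(\<exists>i. P x i) \<longleftrightarrow> (\<exists>s. R (ppair x (pfst s)) (psnd s))"
      unfolding * by (metis pfst_ppair psnd_ppair)
  qed
qed

lemma sigma1_in_conj [sigma1_intros]:
  assumes "sigma1_in A P" "sigma1_in A Q" shows "sigma1_in A (\<lambda>x. P x \<and> Q x)"
proof -
  obtain R where R: "decidable_in A (\<lambda>z. R (pfst z) (psnd z))" "\<And>x. P x \<longleftrightarrow> (\<exists>s. R x s)"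
    using assms unfolding sigma1_in_def by blast
  obtain R' where R': "decidable_in A (\<lambda>z. R' (pfst z) (psnd z))" "\<And>x. Q x \<longleftrightarrow> (\<exists>s. R' x s)"
    using assms unfolding sigma1_in_def by blast
  show ?thesis
  proof (rule sigI[where R = "\<lambda>x s. R x (pfst s) \<and> R' x (psnd s)"])
    show "decidable_in A (\<lambda>z. R (pfst z) (pfst (psnd z)) \<and> R' (pfst z) (psnd (psnd z)))"
      by (intro decidable_in_comp2[OF R(1)] decidable_in_comp2[OF R'(1)] recursive_intros)
    fix x show "P x \<and> Q x \<longleftrightarrow> (\<exists>s. R x (pfst s) \<and> R' x (psnd s))"
      unfolding R R' by (metis pfst_ppair psnd_ppair)
  qed
qed

lemma sigma1_in_disj [sigma1_intros]:
  assumes "sigma1_in A P" "sigma1_in A Q" shows "sigma1_in A (\<lambda>x. P x \<or> Q x)"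
proof -
  obtain R where R: "decidable_in A (\<lambda>z. R (pfst z) (psnd z))" "\<And>x. P x \<longleftrightarrow> (\<exists>s. R x s)"
    using assms unfolding sigma1_in_def by blast
  obtain R' where R': "decidable_in A (\<lambda>z. R' (pfst z) (psnd z))" "\<And>x. Q x \<longleftrightarrow> (\<exists>s. R' x s)"
    using assms unfolding sigma1_in_def by blast
  show ?thesis
  proof (rule sigI[where R = "\<lambda>x s. R x s \<or> R' x s"])
    show "decidable_in A (\<lambda>z. R (pfst z) (psnd z) \<or> R' (pfst z) (psnd z))"
      by (intro decidable_in_disj R(1) R'(1))
  qed (auto simp: R R')
qed

text \<open>Finitely many witnesses have a common strict bound, and this bound serves as the single
  outer witness.\<close>

lemma sigma1_in_all_less [sigma1_intros]:
  assumes "sigma1_in A (\<lambda>z. P (pfst z) (psnd z))" "recursive_in A b"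
  shows "sigma1_in A (\<lambda>x. \<forall>i<b x. P x i)"
proof -
  obtain R where R: "decidable_in A (\<lambda>z. R (pfst z) (psnd z))"
      "\<And>z. P (pfst z) (psnd z) \<longleftrightarrow> (\<exists>s. R z s)"
    using assms unfolding sigma1_in_def by blast
  have *: "P x i \<longleftrightarrow> (\<exists>s. R (ppair x i) s)" for x i using R(2)[of "ppair x i"] by simp
  show ?thesis
  proof (rule sigI[where R = "\<lambda>x s. \<forall>i<b x. \<exists>t<s. R (ppair x i) t"])
    show "decidable_in A (\<lambda>z. \<forall>i<b (pfst z). \<exists>t<psnd z. R (ppair (pfst z) i) t)"
      by (intro decidable_in_comp2[OF R(1)] recursive_in_comp[OF assms(2)] recursive_intros)
    fix x
    have "\<exists>s. \<forall>i<n. \<exists>t<s. R (ppair x i) t" if "\<forall>i<n. \<exists>t. R (ppair x i) t" for n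
      using that
    proof (induction n)
      case (Suc n)
      then obtain s where s: "\<forall>i<n. \<exists>t<s. R (ppair x i) t" by auto
      obtain t where "R (ppair x n) t" using Suc.prems by blast
      then show ?case
        using s by (intro exI[of _ "max s (Suc t)"]) (auto simp: less_Suc_eq less_max_iff_disj)
    qed simp
    then show "(\<forall>i<b x. P x i) \<longleftrightarrow> (\<exists>s. \<forall>i<b x. \<exists>t<s. R (ppair x i) t)"
      unfolding * by blast
  qed
qed

lemma sigma1_in_all_le [sigma1_intros]:
  assumes "sigma1_in A (\<lambda>z. P (pfst z) (psnd z))" "recursive_in A b"
  shows "sigma1_in A (\<lambda>x. \<forall>i\<le>b x. P x i)"
  using sigma1_in_all_less[OF assms(1) recursive_in_Suc[OF assms(2)]] by (simp add: less_Suc_eq_le)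

lemma sigma1_in_ex_less [sigma1_intros]:
  assumes "sigma1_in A (\<lambda>z. P (pfst z) (psnd z))" "recursive_in A b"
  shows "sigma1_in A (\<lambda>x. \<exists>i<b x. P x i)"
  by (intro sigma1_intros assms sigma1_in_decidable[OF decidable_in_less] recursive_in_comp[OF assms(2)] recursive_intros)

lemma sigma1_in_ex_le [sigma1_intros]:
  assumes "sigma1_in A (\<lambda>z. P (pfst z) (psnd z))" "recursive_in A b"
  shows "sigma1_in A (\<lambda>x. \<exists>i\<le>b x. P x i)"
  using sigma1_in_ex_less[OF assms(1) recursive_in_Suc[OF assms(2)]] by (simp add: less_Suc_eq_le)

section \<open>Stagewise enumeration of all computations\<close>

fun prog_code :: "oprog \<Rightarrow> nat" where
  "prog_code OZero = ppair 0 0"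
| "prog_code OSucc = ppair 1 0"
| "prog_code OFst = ppair 2 0"
| "prog_code OSnd = ppair 3 0"
| "prog_code OQuery = ppair 4 0"
| "prog_code (OPair p q) = ppair 5 (ppair (prog_code p) (prog_code q))"
| "prog_code (OComp p q) = ppair 6 (ppair (prog_code p) (prog_code q))"
| "prog_code (ORec p q) = ppair 7 (ppair (prog_code p) (prog_code q))"
| "prog_code (OMu p) = ppair 8 (prog_code p)"

definition known :: "nat \<Rightarrow> nat \<Rightarrow> nat \<Rightarrow> nat \<Rightarrow> bool" where
  "known S e x y \<longleftrightarrow> ppair e (ppair x y) \<in> set_decode S"

text \<open>A number \<open>S\<close> is read as a finite set of triples (program code, input, output). The triple with
  program code \<open>ppair k d\<close> is derivable if it follows from the triples in \<open>S\<close> by one rule of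
  \<^const>\<open>computes\<close>.\<close>

definition derivable :: "(nat \<Rightarrow> bool) \<Rightarrow> nat \<Rightarrow> nat \<Rightarrow> nat \<Rightarrow> nat \<Rightarrow> nat \<Rightarrow> bool" where
  "derivable A S k d x y \<longleftrightarrow>
    k = 0 \<and> y = 0 \<or>
    k = 1 \<and> y = Suc x \<or>
    k = 2 \<and> y = pfst x \<or>
    k = 3 \<and> y = psnd x \<or>
    k = 4 \<and> y = of_bool (A x) \<or>
    k = 5 \<and> known S (pfst d) x (pfst y) \<and> known S (psnd d) x (psnd y) \<or>
    k = 6 \<and> (\<exists>z. known S (psnd d) x z \<and> known S (pfst d) z y) \<or>
    k = 7 \<and> psnd x = 0 \<and> known S (pfst d) (pfst x) y \<or>
    k = 7 \<and> 0 < psnd x \<and> (\<exists>r. known S (ppair k d) (ppair (pfst x) (psnd x - 1)) r \<and>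
      known S (psnd d) (ppair (pfst x) (ppair (psnd x - 1) r)) y) \<or>
    k = 8 \<and> known S d (ppair x y) 0 \<and> (\<forall>m<y. \<exists>z. known S d (ppair x m) (Suc z))"

text \<open>Admitting only triples below \<open>t\<close> keeps every stage finite, so that the stages are computable by
  primitive recursion and no coding of derivations is needed.\<close>

definition stage :: "(nat \<Rightarrow> bool) \<Rightarrow> nat \<Rightarrow> nat" where
  "stage A t = rec_nat 0 (\<lambda>t S. set_encode {u. u < t \<and>
     derivable A S (pfst (pfst u)) (psnd (pfst u)) (pfst (psnd u)) (psnd (psnd u))}) t"

lemma stage_0: "stage A 0 = 0"
  by (simp add: stage_def)

lemma known_stage_Suc: "known (stage A (Suc t)) e x y \<longleftrightarrow>
    ppair e (ppair x y) < t \<and> derivable A (stage A t) (pfst e) (psnd e) x y"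
  by (simp add: stage_def known_def)

text \<open>A set bit at position u forces S to be at least \<open>2 ^ u\<close>, which exceeds u
  and hence all components of the triple coded by u.\<close>

lemma known_less: "known S e x y \<Longrightarrow> e < S \<and> x < S \<and> y < S"
proof -
  assume "known S e x y"
  then have "2 ^ ppair e (ppair x y) \<le> S"
    unfolding known_def set_decode_def
    by (metis div_less even_zero mem_Collect_eq not_less)
  then have "ppair e (ppair x y) < S" by (meson less_exp less_le_trans)
  then show ?thesis by (meson le_ppair le_less_trans)
qed

lemma derivable_mono:
  assumes "\<And>e x y. known S e x y \<Longrightarrow> known S' e x y" "derivable A S k d x y"
  shows "derivable A S' k d x y"
  using assms(2)[unfolded derivable_def]
proof (elim disjE)
  assume "k = 8 \<and> known S d (ppair x y) 0 \<and> (\<forall>m<y. \<exists>z. known S d (ppair x m) (Suc z))"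
  then show ?thesis using assms(1) by (simp add: derivable_def) blast
next
  assume "k = 6 \<and> (\<exists>z. known S (psnd d) x z \<and> known S (pfst d) z y)"
  then show ?thesis using assms(1) by (simp add: derivable_def) blast
next
  assume "k = 7 \<and> 0 < psnd x \<and> (\<exists>r. known S (ppair k d) (ppair (pfst x) (psnd x - 1)) r \<and>
      known S (psnd d) (ppair (pfst x) (ppair (psnd x - 1) r)) y)"
  then show ?thesis using assms(1) by (simp add: derivable_def) blast
qed (auto simp: derivable_def intro: assms(1))

text \<open>Every witness occurs inside a triple of S and is therefore below S. In this form
  \<open>derivable\<close> is visibly decidable.\<close>

lemma derivable_bounded: "derivable A S k d x y \<longleftrightarrow>
    k = 0 \<and> y = 0 \<or>
    k = 1 \<and> y = Suc x \<or>
    k = 2 \<and> y = pfst x \<or>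
    k = 3 \<and> y = psnd x \<or>
    k = 4 \<and> y = of_bool (A x) \<or>
    k = 5 \<and> known S (pfst d) x (pfst y) \<and> known S (psnd d) x (psnd y) \<or>
    k = 6 \<and> (\<exists>z<S. known S (psnd d) x z \<and> known S (pfst d) z y) \<or>
    k = 7 \<and> psnd x = 0 \<and> known S (pfst d) (pfst x) y \<or>
    k = 7 \<and> 0 < psnd x \<and> (\<exists>r<S. known S (ppair k d) (ppair (pfst x) (psnd x - 1)) r \<and>
      known S (psnd d) (ppair (pfst x) (ppair (psnd x - 1) r)) y) \<or>
    k = 8 \<and> known S d (ppair x y) 0 \<and> (\<forall>m<y. \<exists>z<S. known S d (ppair x m) (Suc z))"
proof -
  have 1: "(\<exists>z. known S (psnd d) x z \<and> known S (pfst d) z y) \<longleftrightarrow>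
      (\<exists>z<S. known S (psnd d) x z \<and> known S (pfst d) z y)"
    using known_less by blast
  have 2: "(\<exists>r. known S (ppair k d) (ppair (pfst x) (psnd x - 1)) r \<and>
      known S (psnd d) (ppair (pfst x) (ppair (psnd x - 1) r)) y) \<longleftrightarrow>
    (\<exists>r<S. known S (ppair k d) (ppair (pfst x) (psnd x - 1)) r \<and>
      known S (psnd d) (ppair (pfst x) (ppair (psnd x - 1) r)) y)"
    using known_less by blast
  have 3: "(\<exists>z. known S d (ppair x m) (Suc z)) \<longleftrightarrow> (\<exists>z<S. known S d (ppair x m) (Suc z))" for m
    using known_less Suc_lessD by blast
  show ?thesis unfolding derivable_def 1 2 3 by (rule refl)
qed

lemma decidable_in_known:
  assumes "recursive_in A s" "recursive_in A e" "recursive_in A f" "recursive_in A g"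
  shows "decidable_in A (\<lambda>x. known (s x) (e x) (f x) (g x))"
  unfolding known_def by (intro recursive_intros assms)

lemma recursive_in_stage:
  assumes f: "recursive_in A f" shows "recursive_in A (\<lambda>x. stage A (f x))"
  unfolding stage_def derivable_bounded by (intro recursive_intros decidable_in_known decidable_in_query f)

text \<open>A stage is recomputed from the previous one rather than added to it; old triples survive
  because their premises do and \<open>derivable\<close> is monotone.\<close>

lemma stage_mono_Suc: "known (stage A t) e x y \<Longrightarrow> known (stage A (Suc t)) e x y"
proof (induction t arbitrary: e x y)
  case 0
  then show ?case by (simp add: stage_0 known_def)
next
  case (Suc t)
  from Suc.prems have b: "ppair e (ppair x y) < t" and d: "derivable A (stage A t) (pfst e) (psnd e) x y"
    unfolding known_stage_Suc by auto
  from d have "derivable A (stage A (Suc t)) (pfst e) (psnd e) x y"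
    by (rule derivable_mono[rotated]) (rule Suc.IH)
  then show ?case using b known_stage_Suc less_SucI by blast
qed

lemma stage_mono:
  assumes "known (stage A t) e x y" "t \<le> t'" shows "known (stage A t') e x y"
  using assms(2) by (induction rule: dec_induct) (use assms(1) stage_mono_Suc in auto)

lemma known_stage_sound: "known (stage A t) (prog_code p) x y \<Longrightarrow> computes A p x y"
proof (induction t arbitrary: p x y)
  case 0
  then show ?case by (simp add: stage_0 known_def)
next
  case (Suc t)
  from Suc.prems have d: "derivable A (stage A t) (pfst (prog_code p)) (psnd (prog_code p)) x y"
    by (simp add: known_stage_Suc)
  show ?case
  proof (cases p)
    case OZero
    then show ?thesis using d by (simp add: derivable_def computes.zero)
  next
    case OSucc
    then show ?thesis using d by (simp add: derivable_def computes.succ)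
  next
    case OFst
    then show ?thesis using d computes.proj1[of A "pfst x" "psnd x"]
      by (simp add: derivable_def flip: ppair_def)
  next
    case OSnd
    then show ?thesis using d computes.proj2[of A "pfst x" "psnd x"]
      by (simp add: derivable_def flip: ppair_def)
  next
    case OQuery
    then show ?thesis using d by (simp add: derivable_def computes.query)
  next
    case (OPair p1 p2)
    then show ?thesis
      using d computes.pair[of A p1 x "pfst y" p2 "psnd y"] Suc.IH
      by (simp add: derivable_def flip: ppair_def)
  next
    case (OComp p1 p2)
    then show ?thesis using d Suc.IH by (auto simp: derivable_def intro: computes.comp)
  next
    case (ORec p1 p2)
    show ?thesis
    proof (cases "psnd x")
      case 0
      then show ?thesis
        using d ORec Suc.IH[of p1] computes.rec_0[of A p1 "pfst x" y p2] ppair_proj[of x]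
        by (simp add: derivable_def flip: ppair_def)
    next
      case (Suc n)
      with d ORec obtain r where "known (stage A t) (prog_code p) (ppair (pfst x) n) r"
        "known (stage A t) (prog_code p2) (ppair (pfst x) (ppair n r)) y"
        by (auto simp: derivable_def)
      then have "computes A p (ppair (pfst x) n) r" "computes A p2 (ppair (pfst x) (ppair n r)) y"
        using Suc.IH by blast+
      then have "computes A p (ppair (pfst x) (Suc n)) y"
        unfolding ORec ppair_def by (rule computes.rec_Suc)
      then show ?thesis using Suc by (metis ppair_proj)
    qed
  next
    case (OMu p1)
    with d Suc.IH have "computes A p1 (ppair x y) 0" "\<forall>m<y. \<exists>z. computes A p1 (ppair x m) (Suc z)"
      unfolding derivable_def by (auto, blast)
    then show ?thesis unfolding OMu ppair_def by (intro computes.mu) auto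
  qed
qed

text \<open>The bound of the current stage may be too small to admit the triple; derivability
  persists until the bound exceeds its code.\<close>

lemma known_stage_intro:
  assumes "derivable A (stage A t) (pfst e) (psnd e) x y"
  shows "\<exists>t. known (stage A t) e x y"
proof -
  let ?t = "max t (Suc (ppair e (ppair x y)))"
  have "derivable A (stage A ?t) (pfst e) (psnd e) x y"
    using assms by (rule derivable_mono[rotated]) (auto intro: stage_mono)
  moreover have "ppair e (ppair x y) < ?t" by simp
  ultimately have "known (stage A (Suc ?t)) e x y" unfolding known_stage_Suc by blast
  then show ?thesis by blast
qed

lemma known_stage_complete: "computes A p x y \<Longrightarrow> \<exists>t. known (stage A t) (prog_code p) x y"
proof (induction rule: computes.induct)
  case (pair p x y q z)
  then obtain t1 t2 where "known (stage A t1) (prog_code p) x y" "known (stage A t2) (prog_code q) x z" by blast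
  then have "known (stage A (max t1 t2)) (prog_code p) x y" "known (stage A (max t1 t2)) (prog_code q) x z"
    by (auto intro: stage_mono)
  then show ?case
    by (intro known_stage_intro[of A "max t1 t2"]) (simp add: derivable_def flip: ppair_def)
next
  case (comp q x y p z)
  then obtain t1 t2 where "known (stage A t1) (prog_code q) x y" "known (stage A t2) (prog_code p) y z" by blast
  then have "known (stage A (max t1 t2)) (prog_code q) x y" "known (stage A (max t1 t2)) (prog_code p) y z"
    by (auto intro: stage_mono)
  then show ?case
    by (intro known_stage_intro[of A "max t1 t2"]) (auto simp: derivable_def)
next
  case (rec_0 p a y q)
  then obtain t where "known (stage A t) (prog_code p) a y" by blast
  then show ?case
    by (intro known_stage_intro[of A t]) (simp add: derivable_def flip: ppair_def)
next
  case (rec_Suc p q a n r y)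
  then obtain t1 t2 where "known (stage A t1) (prog_code (ORec p q)) (ppair a n) r"
    "known (stage A t2) (prog_code q) (ppair a (ppair n r)) y" unfolding ppair_def by blast
  then have "known (stage A (max t1 t2)) (prog_code (ORec p q)) (ppair a n) r"
    "known (stage A (max t1 t2)) (prog_code q) (ppair a (ppair n r)) y"
    by (auto intro: stage_mono)
  then show ?case
    by (intro known_stage_intro[of A "max t1 t2"])
      (auto simp: derivable_def simp flip: ppair_def)
next
  case (mu p a n)
  obtain t1 where t1: "known (stage A t1) (prog_code p) (ppair a n) 0" using mu unfolding ppair_def by blast
  \<comment> \<open>The premises for the places below n may appear at different stages; induction on
    k finds one stage that contains them all.\<close>
  have "\<exists>t. \<forall>m<k. \<exists>y. known (stage A t) (prog_code p) (ppair a m) (Suc y)" if "k \<le> n" for k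
    using that
  proof (induction k)
    case (Suc k)
    then obtain t where t: "\<forall>m<k. \<exists>y. known (stage A t) (prog_code p) (ppair a m) (Suc y)" by auto
    obtain y t' where "known (stage A t') (prog_code p) (ppair a k) (Suc y)"
      using mu.IH(2)[of k] Suc.prems unfolding ppair_def by auto
    then show ?case using t
      by (intro exI[of _ "max t t'"]) (metis less_SucE max.cobounded1 max.cobounded2 stage_mono)
  qed simp
  then obtain t2 where t2: "\<forall>m<n. \<exists>y. known (stage A t2) (prog_code p) (ppair a m) (Suc y)" by blast
  let ?t = "max t1 t2"
  have "known (stage A ?t) (prog_code p) (ppair a n) 0" using t1 by (auto intro: stage_mono)
  moreover have "\<exists>y<stage A ?t. known (stage A ?t) (prog_code p) (ppair a m) (Suc y)" if "m < n" for m
    using t2 that by (meson Suc_lessD known_less max.cobounded2 stage_mono)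
  ultimately show ?case
    by (intro known_stage_intro[of A ?t]) (auto simp: derivable_def)
qed (auto intro!: known_stage_intro[of A 0 for A] simp: derivable_def simp flip: ppair_def)

lemma computes_iff_known_stage: "computes A p x y \<longleftrightarrow> (\<exists>t. known (stage A t) (prog_code p) x y)"
  using known_stage_sound known_stage_complete by blast

text \<open>One number s bounds both the stage and the output. The relation is thereby decidable and
  monotone in s, and any number e can serve as the index of a c.e. set.\<close>

definition halts_by :: "(nat \<Rightarrow> bool) \<Rightarrow> nat \<Rightarrow> nat \<Rightarrow> nat \<Rightarrow> bool" where
  "halts_by A e x s \<longleftrightarrow> (\<exists>y<s. known (stage A s) e x y)"

lemma halts_by_mono: "halts_by A e x s \<Longrightarrow> s \<le> s' \<Longrightarrow> halts_by A e x s'"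
  unfolding halts_by_def using stage_mono less_le_trans by blast

lemma decidable_in_halts_by [recursive_intros]:
  assumes "recursive_in A e" "recursive_in A f" "recursive_in A g"
  shows "decidable_in A (\<lambda>x. halts_by A (e x) (f x) (g x))"
proof (rule decidable_in_comp3[OF _ assms])
  show "decidable_in A (\<lambda>z. halts_by A (pfst z) (pfst (psnd z)) (psnd (psnd z)))"
    unfolding halts_by_def by (intro recursive_intros decidable_in_known recursive_in_stage)
qed

lemma ex_computes_iff: "(\<exists>y. computes A p x y) \<longleftrightarrow> (\<exists>s. halts_by A (prog_code p) x s)"
proof
  assume "\<exists>y. computes A p x y"
  then obtain y t where "known (stage A t) (prog_code p) x y" unfolding computes_iff_known_stage by blast
  then have "halts_by A (prog_code p) x (max t (Suc y))"
    unfolding halts_by_def by (intro exI[of _ y]) (auto intro: stage_mono)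
  then show "\<exists>s. halts_by A (prog_code p) x s" by blast
qed (auto simp: halts_by_def computes_iff_known_stage)

lemma ce_in_iff_sigma1_in: "ce_in A W \<longleftrightarrow> sigma1_in A (\<lambda>x. x \<in> W)"
proof
  assume "ce_in A W"
  then obtain p where W: "W = {x. \<exists>y. computes A p x y}" unfolding ce_in_def by blast
  show "sigma1_in A (\<lambda>x. x \<in> W)"
  proof (rule sigI[where R = "\<lambda>x s. halts_by A (prog_code p) x s"])
    show "decidable_in A (\<lambda>z. halts_by A (prog_code p) (pfst z) (psnd z))" by (intro recursive_intros)
  qed (auto simp: W ex_computes_iff)
next
  assume "sigma1_in A (\<lambda>x. x \<in> W)"
  then obtain R where R: "decidable_in A (\<lambda>z. R (pfst z) (psnd z))" "\<And>x. x \<in> W \<longleftrightarrow> (\<exists>s. R x s)"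
    unfolding sigma1_in_def by blast
  \<comment> \<open>\<open>OMu\<close> looks for a zero, so the program must return 0 exactly at the
    witnesses; the search then halts at the least one.\<close>
  obtain p where p: "\<And>z. computes A p z (of_bool (\<not> R (pfst z) (psnd z)))"
    using recursive_in_of_bool[OF decidable_in_not[OF R(1)]] unfolding recursive_in_def by blast
  have "(\<exists>y. computes A (OMu p) x y) \<longleftrightarrow> x \<in> W" for x
  proof
    assume "\<exists>y. computes A (OMu p) x y"
    then obtain n where "computes A p (ppair x n) 0" by (auto elim: computes_muE simp: ppair_def)
    then have "of_bool (\<not> R x n) = (0::nat)"
      using p[of "ppair x n"] computes_deterministic by fastforce
    then show "x \<in> W" using R(2) by auto
  next
    assume "x \<in> W"
    then have ex: "\<exists>s. R x s" using R(2) by blast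
    define n where "n = (LEAST s. R x s)"
    have "R x n" unfolding n_def using ex by (rule LeastI_ex)
    then have "computes A p (ppair x n) 0" using p[of "ppair x n"] by simp
    moreover have "computes A p (ppair x m) (Suc 0)" if "m < n" for m
      using p[of "ppair x m"] not_less_Least[of m "R x"] that by (simp add: n_def)
    ultimately show "\<exists>y. computes A (OMu p) x y" unfolding ppair_def by (blast intro: computes.mu)
  qed
  then show "ce_in A W" unfolding ce_in_def by (intro exI[of _ p] exI[of _ "OMu p"]) blast
qed

lemma sigma1_in_universal:
  assumes "sigma1_in A P" obtains e where "\<And>x. P x \<longleftrightarrow> (\<exists>s. halts_by A e x s)"
proof -
  have "ce_in A {x. P x}" using assms by (simp add: ce_in_iff_sigma1_in)
  then obtain p where "{x. P x} = {x. \<exists>y. computes A p x y}" unfolding ce_in_def by blast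
  then show thesis using that[of "prog_code p"] ex_computes_iff by blast
qed

section \<open>Coded strings and the measure on Cantor space\<close>

text \<open>A string of length \<open>n\<close> is coded by the pair of \<open>n\<close> and the number below \<open>2 ^ n\<close> with these binary digits.\<close>

definition restrict_code :: "nat \<Rightarrow> nat \<Rightarrow> nat" where
  "restrict_code a k = set_encode {i. i < k \<and> i \<in> set_decode a}"

definition prefix_code :: "(nat \<Rightarrow> bool) \<Rightarrow> nat \<Rightarrow> nat" where
  "prefix_code X n = set_encode {i. i < n \<and> X i}"

lemma recursive_in_restrict_code [recursive_intros]:
  assumes "recursive_in A f" "recursive_in A g" shows "recursive_in A (\<lambda>x. restrict_code (f x) (g x))"
  unfolding restrict_code_def by (intro recursive_intros recursive_in_comp[OF assms(1)] assms)

lemma recursive_in_prefix_code: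
  assumes "decidable_in A X" "recursive_in A f" shows "recursive_in A (\<lambda>x. prefix_code X (f x))"
  unfolding prefix_code_def by (intro recursive_intros decidable_in_comp[OF assms(1)] assms(2))

lemma finite_less_conj [simp]: "finite {i. i < (n::nat) \<and> P i}"
  by (rule finite_subset[of _ "{..<n}"]) auto

lemma set_decode_restrict_code [simp]: "set_decode (restrict_code a k) = {i. i < k \<and> i \<in> set_decode a}"
  by (simp add: restrict_code_def set_encode_inverse)

lemma set_decode_prefix_code [simp]: "set_decode (prefix_code X n) = {i. i < n \<and> X i}"
  by (simp add: prefix_code_def set_encode_inverse)

lemma set_decode_eq_iff: "set_decode a = set_decode b \<longleftrightarrow> a = b"
  by (metis set_decode_inverse)

lemma restrict_prefix_code: "k \<le> n \<Longrightarrow> restrict_code (prefix_code X n) k = prefix_code X k"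
  by (subst set_decode_eq_iff[symmetric]) auto

lemma restrict_restrict_code: "k \<le> n \<Longrightarrow> restrict_code (restrict_code a n) k = restrict_code a k"
  by (subst set_decode_eq_iff[symmetric]) auto

lemma set_encode_less: "S \<subseteq> {..<n} \<Longrightarrow> set_encode S < 2 ^ n"
proof -
  assume "S \<subseteq> {..<n}"
  then have "set_encode S \<le> (\<Sum>i<n. 2 ^ i)"
    unfolding set_encode_def by (intro sum_mono2) auto
  also have "\<dots> < 2 ^ n" by (induction n) auto
  finally show ?thesis .
qed

lemma prefix_code_less: "prefix_code X n < 2 ^ n" and restrict_code_less: "restrict_code a n < 2 ^ n"
  unfolding prefix_code_def restrict_code_def by (auto intro!: set_encode_less)

lemma set_decode_subset: "a < 2 ^ n \<Longrightarrow> set_decode a \<subseteq> {..<n}"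
proof
  fix i assume a: "a < 2 ^ n" and i: "i \<in> set_decode a"
  show "i \<in> {..<n}"
  proof (rule ccontr)
    assume "i \<notin> {..<n}"
    then have "a < 2 ^ i" using a less_le_trans[OF a power_increasing[of n i "2::nat"]] by simp
    then show False using i by (simp add: set_decode_def)
  qed
qed

lemma restrict_code_eq: "a < 2 ^ n \<Longrightarrow> restrict_code a n = a"
  using set_decode_subset[of a n] by (subst set_decode_eq_iff[symmetric]) auto

lemma prefix_code_eq_iff: "prefix_code X n = prefix_code Y n \<longleftrightarrow> (\<forall>i<n. X i = Y i)"
  by (subst set_decode_eq_iff[symmetric]) (auto simp: set_eq_iff)

lemma prefix_code_eq_restrict_iff: "prefix_code X n = restrict_code a n \<longleftrightarrow> (\<forall>i<n. X i \<longleftrightarrow> i \<in> set_decode a)"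
  by (subst set_decode_eq_iff[symmetric]) (auto simp: set_eq_iff)

lemma prefix_code_eq_nat_iff:
  "a < 2 ^ n \<Longrightarrow> prefix_code X n = a \<longleftrightarrow> (\<forall>i<n. X i \<longleftrightarrow> i \<in> set_decode a)"
  using prefix_code_eq_restrict_iff[of X n a] by (simp add: restrict_code_eq)

definition bits :: "nat \<Rightarrow> nat \<Rightarrow> bool list" where
  "bits n a = map (\<lambda>i. i \<in> set_decode a) [0..<n]"

lemma length_bits [simp]: "length (bits n a) = n" and nth_bits: "i < n \<Longrightarrow> bits n a ! i \<longleftrightarrow> i \<in> set_decode a"
  by (simp_all add: bits_def)

lemma mem_cylinder_iff: "X \<in> cylinder \<sigma> \<longleftrightarrow> \<sigma> = bits (length \<sigma>) (prefix_code X (length \<sigma>))"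
  unfolding cylinder_def by (auto simp: list_eq_iff_nth_eq nth_bits)

lemma inj_string_code: "inj string_code"
proof (rule injI)
  fix x y assume "string_code x = string_code y"
  then have "map (of_bool :: bool \<Rightarrow> nat) x = map of_bool y"
    unfolding string_code_def by (simp add: inj_eq[OF inj_list_encode[of UNIV]])
  then show "x = y"
    by (rule map_injective) (auto simp: inj_def of_bool_def split: if_splits)
qed

lemma recursive_in_string_code_bits:
  assumes "recursive_in A f" "recursive_in A g" shows "recursive_in A (\<lambda>x. string_code (bits (f x) (g x)))"
proof (rule recursive_in_comp2[OF _ assms])
  \<comment> \<open>List codes grow at the front, so the recursion runs through the suffixes of the
    string and step j prepends the bit at \<open>n - Suc j\<close>.\<close>
  have *: "rec_nat 0 (\<lambda>j r. Suc (ppair (of_bool (n - Suc j \<in> set_decode a)) r)) k =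
    list_encode (map of_bool (map (\<lambda>i. i \<in> set_decode a) [n - k..<n]))" if "k \<le> n" for n a k
    using that
  proof (induction k)
    case (Suc k)
    then have "[n - Suc k..<n] = (n - Suc k) # [n - k..<n]"
      by (simp add: upt_conv_Cons Suc_diff_Suc)
    with Suc show ?case by (simp add: ppair_def)
  qed simp
  have "recursive_in A (\<lambda>z. rec_nat 0 (\<lambda>j r. Suc (ppair (of_bool (pfst z - Suc j \<in> set_decode (psnd z))) r)) (pfst z))"
    by (intro recursive_intros)
  then show "recursive_in A (\<lambda>z. string_code (bits (pfst z) (psnd z)))"
    by (subst (asm) *) (simp_all add: string_code_def bits_def)
qed

section \<open>Effectively open classes through coded prefixes\<close>

abbreviation sigma1_in3 :: "(nat \<Rightarrow> bool) \<Rightarrow> (nat \<Rightarrow> nat \<Rightarrow> nat \<Rightarrow> bool) \<Rightarrow> bool" where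
  "sigma1_in3 A Q \<equiv> sigma1_in A (\<lambda>z. Q (pfst z) (pfst (psnd z)) (psnd (psnd z)))"

abbreviation decidable_in3 :: "(nat \<Rightarrow> bool) \<Rightarrow> (nat \<Rightarrow> nat \<Rightarrow> nat \<Rightarrow> bool) \<Rightarrow> bool" where
  "decidable_in3 A Q \<equiv> decidable_in A (\<lambda>z. Q (pfst z) (pfst (psnd z)) (psnd (psnd z)))"

text \<open>Together with the next lemma this replaces lists and cylinders by conditions on
  \<open>prefix_code X n\<close>, the form in which all later open sets are given.\<close>

lemma unif_sigma1I:
  assumes Q: "sigma1_in3 A Q" and U: "\<And>i X. X \<in> U i \<longleftrightarrow> (\<exists>n. Q i n (prefix_code X n))"
  shows "unif_sigma1 A U"
proof -
  \<comment> \<open>Restricting a to its first n bits lets a range over all numbers while Q is asked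
    only about codes of strings of length n.\<close>
  define W where "W = {x. \<exists>n a. psnd x = string_code (bits n a) \<and> Q (pfst x) n (restrict_code a n)}"
  have "ce_in A W"
    unfolding W_def ce_in_iff_sigma1_in mem_Collect_eq
    by (intro sigma1_intros sigma1_in_decidable[OF decidable_in_eq] sigma1_in_comp3[OF Q] recursive_in_string_code_bits recursive_intros)
  moreover have "U i = (\<Union>\<sigma>\<in>{\<sigma>. prod_encode (i, string_code \<sigma>) \<in> W}. cylinder \<sigma>)" for i
  proof (intro set_eqI iffI)
    fix X assume "X \<in> U i"
    then obtain n where n: "Q i n (prefix_code X n)" using U by blast
    have "X \<in> cylinder (bits n (prefix_code X n))" by (simp add: mem_cylinder_iff)
    moreover have "prod_encode (i, string_code (bits n (prefix_code X n))) \<in> W"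
      unfolding W_def ppair_def[symmetric] using n
      by simp (metis restrict_prefix_code order_refl)
    ultimately show "X \<in> (\<Union>\<sigma>\<in>{\<sigma>. prod_encode (i, string_code \<sigma>) \<in> W}. cylinder \<sigma>)" by blast
  next
    fix X assume "X \<in> (\<Union>\<sigma>\<in>{\<sigma>. prod_encode (i, string_code \<sigma>) \<in> W}. cylinder \<sigma>)"
    then obtain \<sigma> n a where X: "X \<in> cylinder \<sigma>"
      and \<sigma>: "string_code \<sigma> = string_code (bits n a)" and Q: "Q i n (restrict_code a n)"
      unfolding W_def ppair_def[symmetric] by auto
    have "\<sigma> = bits n a" using \<sigma> inj_string_code by (simp add: inj_eq)
    then have "prefix_code X n = restrict_code a n"
      using X by (auto simp: cylinder_def prefix_code_eq_restrict_iff nth_bits)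
    then show "X \<in> U i" using Q U by metis
  qed
  ultimately show ?thesis unfolding unif_sigma1_def by blast
qed

text \<open>The length n bounds at once the generating string and the stage at which it is
  enumerated. Waiting for longer prefixes thus turns a c.e. condition into a decidable one that is
  preserved under extension.\<close>

lemma unif_sigma1E:
  assumes "unif_sigma1 A U"
  obtains Q where "decidable_in3 A Q" "\<And>i m n X. m \<le> n \<Longrightarrow> Q i m (prefix_code X m) \<Longrightarrow> Q i n (prefix_code X n)"
    "\<And>i X. X \<in> U i \<longleftrightarrow> (\<exists>n. Q i n (prefix_code X n))"
proof -
  obtain W where W: "ce_in A W"
    and U: "\<And>n. U n = (\<Union>\<sigma> \<in> {\<sigma>. prod_encode (n, string_code \<sigma>) \<in> W}. cylinder \<sigma>)"
    using assms unfolding unif_sigma1_def by blast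
  obtain R where R: "decidable_in A (\<lambda>z. R (pfst z) (psnd z))" "\<And>x. x \<in> W \<longleftrightarrow> (\<exists>s. R x s)"
    using W unfolding ce_in_iff_sigma1_in sigma1_in_def by blast
  define Q where "Q i n a \<longleftrightarrow> (\<exists>k\<le>n. \<exists>s\<le>n. R (ppair i (string_code (bits k (restrict_code a k)))) s)" for i n a
  show thesis
  proof
    show "decidable_in3 A Q" unfolding Q_def
      by (intro recursive_intros decidable_in_comp2[OF R(1)] recursive_in_string_code_bits)
    show "Q i n (prefix_code X n)" if "m \<le> n" "Q i m (prefix_code X m)" for i m n X
      using that unfolding Q_def by (metis order_trans restrict_prefix_code)
    fix i X
    show "X \<in> U i \<longleftrightarrow> (\<exists>n. Q i n (prefix_code X n))"
    proof
      assume "X \<in> U i"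
      then obtain \<sigma> s where "X \<in> cylinder \<sigma>" "R (ppair i (string_code \<sigma>)) s"
        unfolding U using R by (auto simp: ppair_def)
      moreover from this obtain l where "\<sigma> = bits l (prefix_code X l)"
        using mem_cylinder_iff by blast
      ultimately have "R (ppair i (string_code (bits l (prefix_code X l)))) s" by simp
      then have "Q i (max l s) (prefix_code X (max l s))"
        unfolding Q_def by (intro exI[of _ l] exI[of _ s] conjI) (simp_all add: restrict_prefix_code)
      then show "\<exists>n. Q i n (prefix_code X n)" by blast
    next
      assume "\<exists>n. Q i n (prefix_code X n)"
      then obtain n k s where "k \<le> n" "R (ppair i (string_code (bits k (restrict_code (prefix_code X n) k)))) s"
        unfolding Q_def by blast
      then have "ppair i (string_code (bits k (prefix_code X k))) \<in> W" using R by (auto simp: restrict_prefix_code)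
      moreover have "X \<in> cylinder (bits k (prefix_code X k))" by (simp add: mem_cylinder_iff)
      ultimately show "X \<in> U i" unfolding U ppair_def by blast
    qed
  qed
qed

section \<open>Fair-coin measure of clopen events\<close>

interpretation cantor: product_prob_space "\<lambda>_. measure_pmf (bernoulli_pmf (1/2))" "UNIV :: nat set"
  rewrites "PiM UNIV (\<lambda>_. measure_pmf (bernoulli_pmf (1/2))) = cantor_measure"
  by unfold_locales (simp_all add: cantor_measure_def)

lemma space_cantor [simp]: "space cantor_measure = UNIV"
  by (simp add: cantor_measure_def space_PiM)

definition fixing :: "nat set \<Rightarrow> (nat \<Rightarrow> bool) \<Rightarrow> (nat \<Rightarrow> bool) set" where
  "fixing J b = {X. \<forall>i\<in>J. X i = b i}"

lemma fixing_measure: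
  assumes "finite J"
  shows "fixing J b \<in> sets cantor_measure" "measure cantor_measure (fixing J b) = (1/2) ^ card J"
proof -
  have eq: "fixing J b = prod_emb UNIV (\<lambda>_. measure_pmf (bernoulli_pmf (1/2))) J (Pi\<^sub>E J (\<lambda>i. {b i}))"
    by (auto simp: fixing_def prod_emb_def restrict_def PiE_def extensional_def Pi_def)
  show "fixing J b \<in> sets cantor_measure"
    unfolding eq cantor_measure_def using assms by (intro sets_PiM_I) auto
  have "measure cantor_measure (fixing J b) = (\<Prod>i\<in>J. measure (measure_pmf (bernoulli_pmf (1/2))) {b i})"
    unfolding eq using assms by (intro cantor.measure_PiM_emb) auto
  also have "\<dots> = (\<Prod>i\<in>J. 1/2)"
    by (intro prod.cong refl) (simp add: measure_pmf_single pmf_bernoulli_half)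
  finally show "measure cantor_measure (fixing J b) = (1/2) ^ card J" by simp
qed

text \<open>The measure of an event about the first n bits is a count of strings, so that comparing
  it with a dyadic rational is an inequality between natural numbers.\<close>

lemma measure_prefix_code_mem:
  shows sets_prefix_code_mem: "{X. P (prefix_code X n)} \<in> sets cantor_measure"
    and "measure cantor_measure {X. P (prefix_code X n)} = card {a. a < 2 ^ n \<and> P a} / 2 ^ n"
proof -
  have F: "X \<in> fixing {..<n} (\<lambda>i. i \<in> set_decode a) \<longleftrightarrow> prefix_code X n = a" if "a < 2 ^ n" for X a
    by (auto simp: fixing_def prefix_code_eq_nat_iff[OF that])
  have eq: "{X. P (prefix_code X n)} = (\<Union>a\<in>{a. a < 2 ^ n \<and> P a}. fixing {..<n} (\<lambda>i. i \<in> set_decode a))"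
    (is "_ = (\<Union>a\<in>?H. ?F a)")
    using prefix_code_less[of _ n] by (auto simp: F)
  show "{X. P (prefix_code X n)} \<in> sets cantor_measure"
    unfolding eq by (intro sets.finite_UN fixing_measure) auto
  have disj: "disjoint_family_on ?F ?H"
    unfolding disjoint_family_on_def
  proof (intro ballI impI)
    fix a b assume "a \<in> ?H" "b \<in> ?H" "a \<noteq> b"
    then show "?F a \<inter> ?F b = {}" by (auto simp: F)
  qed
  have "measure cantor_measure {X. P (prefix_code X n)} = (\<Sum>a\<in>?H. measure cantor_measure (?F a))"
    unfolding eq by (intro cantor.finite_measure_finite_Union disj) (auto intro: fixing_measure)
  also have "\<dots> = (\<Sum>a\<in>?H. (1/2) ^ n)" by (intro sum.cong refl) (simp add: fixing_measure)
  also have "\<dots> = card ?H / 2 ^ n" by (simp add: power_one_over)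
  finally show "measure cantor_measure {X. P (prefix_code X n)} = card ?H / 2 ^ n" .
qed

lemma sets_unif_sigma1: "unif_sigma1 A U \<Longrightarrow> U i \<in> sets cantor_measure"
proof (erule unif_sigma1E)
  fix Q assume "\<And>i X. X \<in> U i \<longleftrightarrow> (\<exists>n. Q i n (prefix_code X n))"
  then have "U i = (\<Union>n. {X. Q i n (prefix_code X n)})" by auto
  then show "U i \<in> sets cantor_measure" using sets_prefix_code_mem by auto
qed

text \<open>Independence of disjoint blocks, by removing one block at a time. The fixed coordinates
  I carry the induction: what is removed with the block of w is again of the same form, with
  \<open>I \<union> J w\<close> in place of I.\<close>

lemma measure_fixing_avoiding:
  assumes "finite F" "\<And>w. w \<in> F \<Longrightarrow> finite (J w)" "disjoint_family_on J F"
    "finite I" "\<And>w. w \<in> F \<Longrightarrow> I \<inter> J w = {}"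
  shows "measure cantor_measure (fixing I b - (\<Union>w\<in>F. fixing (J w) (\<lambda>_. False))) =
    (1/2) ^ card I * (\<Prod>w\<in>F. 1 - (1/2) ^ card (J w))"
  using assms
proof (induction F arbitrary: I b rule: finite_induct)
  case empty
  then show ?case by (simp add: fixing_measure)
next
  case (insert w F)
  let ?N = "\<lambda>w. fixing (J w) (\<lambda>_. False)"
  \<comment> \<open>The pattern agrees with b on I and is false elsewhere, hence false on the new
    block, which is disjoint from I.\<close>
  let ?b = "\<lambda>i. i \<in> I \<and> b i"
  have disj: "disjoint_family_on J F" using insert.prems by (auto simp: disjoint_family_on_def)
  have Jw: "J w \<inter> J v = {}" if "v \<in> F" for v
    using insert.prems(2) insert.hyps that by (auto simp: disjoint_family_on_def)
  have U: "(\<Union>v\<in>F. ?N v) \<in> sets cantor_measure"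
    using insert by (intro sets.finite_UN fixing_measure) auto
  have IJ: "I \<inter> J w = {}" "finite (J w)" using insert.prems by auto
  have eq: "fixing (I \<union> J w) ?b = fixing I b \<inter> ?N w"
    using IJ by (auto simp: fixing_def)
  have "measure cantor_measure (fixing I b - (\<Union>v\<in>insert w F. ?N v)) =
    measure cantor_measure ((fixing I b - (\<Union>v\<in>F. ?N v)) - (fixing (I \<union> J w) ?b - (\<Union>v\<in>F. ?N v)))"
    unfolding eq by (rule arg_cong[where f = "measure cantor_measure"]) auto
  also have "\<dots> = measure cantor_measure (fixing I b - (\<Union>v\<in>F. ?N v)) -
      measure cantor_measure (fixing (I \<union> J w) ?b - (\<Union>v\<in>F. ?N v))"
    using insert.prems IJ U unfolding eq
    by (intro cantor.finite_measure_Diff sets.Diff sets.Int fixing_measure) auto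
  also have "measure cantor_measure (fixing I b - (\<Union>v\<in>F. ?N v)) =
      (1/2) ^ card I * (\<Prod>w\<in>F. 1 - (1/2) ^ card (J w))"
    using insert.prems disj by (intro insert.IH) auto
  also have "measure cantor_measure (fixing (I \<union> J w) ?b - (\<Union>v\<in>F. ?N v)) =
      (1/2) ^ card (I \<union> J w) * (\<Prod>w\<in>F. 1 - (1/2) ^ card (J w))"
    using insert.prems disj Jw IJ by (intro insert.IH) (simp_all add: Int_Un_distrib2)
  also have "card (I \<union> J w) = card I + card (J w)"
    using IJ insert.prems by (intro card_Un_disjoint) auto
  finally show ?case using insert.hyps by (simp add: power_add algebra_simps)
qed

section \<open>Covering sets c.e. in a low oracle\<close>

lemma unif_sigma1_Un:
  assumes "unif_sigma1 A U" "unif_sigma1 A V" shows "unif_sigma1 A (\<lambda>i. U i \<union> V i)"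
proof -
  obtain Q where Q: "decidable_in3 A Q" "\<And>i X. X \<in> U i \<longleftrightarrow> (\<exists>n. Q i n (prefix_code X n))"
    using assms(1) by (rule unif_sigma1E) blast
  obtain R where R: "decidable_in3 A R" "\<And>i X. X \<in> V i \<longleftrightarrow> (\<exists>n. R i n (prefix_code X n))"
    using assms(2) by (rule unif_sigma1E) blast
  show ?thesis
  proof (rule unif_sigma1I)
    show "sigma1_in3 A (\<lambda>i n a. Q i n a \<or> R i n a)" by (intro sigma1_intros sigma1_in_decidable Q(1) R(1))
  qed (auto simp: Q(2) R(2))
qed

lemma unif_sigma1_const:
  assumes "unif_sigma1 A U" shows "unif_sigma1 A (\<lambda>_. U i)"
proof -
  obtain Q where Q: "decidable_in3 A Q" "\<And>i X. X \<in> U i \<longleftrightarrow> (\<exists>n. Q i n (prefix_code X n))"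
    using assms(1) by (rule unif_sigma1E) blast
  show ?thesis
  proof (rule unif_sigma1I)
    show "sigma1_in3 A (\<lambda>_ n a. Q i n a)" by (intro sigma1_in_decidable decidable_in_comp3[OF Q(1)] recursive_intros)
  qed (auto simp: Q(2))
qed

text \<open>Adding this set to V confines the complement of V to a single cylinder.\<close>

lemma unif_sigma1_prefix_code_neq: "unif_sigma1 A (\<lambda>_. {X. prefix_code X N \<noteq> a})"
proof (rule unif_sigma1I)
  show "sigma1_in3 A (\<lambda>_ n c. n = N \<and> c \<noteq> a)" by (intro sigma1_in_decidable recursive_intros)
qed auto

lemma measure_UN_le:
  fixes W :: "nat set"
  assumes "\<And>w. S w \<in> sets cantor_measure"
    and "\<And>F. finite F \<Longrightarrow> F \<subseteq> W \<Longrightarrow> (\<Sum>w\<in>F. measure cantor_measure (S w)) \<le> K"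
  shows "measure cantor_measure (\<Union>w\<in>W. S w) \<le> K"
proof -
  let ?U = "\<lambda>n. \<Union>w\<in>W \<inter> {..<n}. S w"
  have U: "range ?U \<subseteq> sets cantor_measure" using assms(1) by auto
  have inc: "incseq ?U" by (auto simp: incseq_def)
  have eq: "(\<Union>n. ?U n) = (\<Union>w\<in>W. S w)" by (auto intro: lessI)
  have lim: "(\<lambda>n. measure cantor_measure (?U n)) \<longlonglongrightarrow> measure cantor_measure (\<Union>w\<in>W. S w)"
    using cantor.finite_Lim_measure_incseq[OF U inc] unfolding eq .
  have "measure cantor_measure (?U n) \<le> K" for n
  proof -
    have "measure cantor_measure (?U n) \<le> (\<Sum>w\<in>W \<inter> {..<n}. measure cantor_measure (S w))"
      using assms(1) by (intro measure_UNION_le) auto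
    also have "\<dots> \<le> K" by (intro assms(2)) auto
    finally show ?thesis .
  qed
  then show ?thesis using lim LIMSEQ_le_const2 by blast
qed

section \<open>Forcing a random point into every level of a test\<close>

text \<open>The index e lists all sequences that are uniformly Sigma-1 without an oracle, so that
  the e-th can be treated at step e of the forcing. Such a sequence need not be a Martin-Loef test,
  and it is avoided only if it is one.\<close>

definition univ_test :: "nat \<Rightarrow> nat \<Rightarrow> (nat \<Rightarrow> bool) set" where
  "univ_test e i = {X. \<exists>n s. halts_by empty_oracle e (ppair i (ppair n (prefix_code X n))) s}"

lemma unif_sigma1_univ_test:
  assumes "unif_sigma1 empty_oracle U" obtains e where "U = univ_test e"
proof -
  obtain Q where Q: "decidable_in3 empty_oracle Q" "\<And>i X. X \<in> U i \<longleftrightarrow> (\<exists>n. Q i n (prefix_code X n))"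
    using assms(1) by (rule unif_sigma1E) blast
  obtain e where e: "\<And>z. Q (pfst z) (pfst (psnd z)) (psnd (psnd z)) \<longleftrightarrow> (\<exists>s. halts_by empty_oracle e z s)"
    using sigma1_in_universal[OF sigma1_in_decidable[OF Q(1)]] by metis
  have e': "Q i n a \<longleftrightarrow> (\<exists>s. halts_by empty_oracle e (ppair i (ppair n a)) s)" for i n a
    using e[of "ppair i (ppair n a)"] by simp
  have "U i = univ_test e i" for i
    unfolding univ_test_def by (intro set_eqI) (simp add: Q(2) e')
  then show thesis using that by blast
qed

text \<open>A forcing condition is the complement of an effectively open V of measure below 1. It is
  first confined to a cylinder inside \<open>U k\<close> that it meets in positive measure, which
  secures the k-th level of U; then a small level of T is removed from it. The bound
  \<open>k \<le> N\<close> lets the successive cylinders determine a point.\<close>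

lemma forcing_step:
  assumes V: "unif_sigma1 empty_oracle (\<lambda>_. V)" "measure cantor_measure V < 1"
    and U: "unif_sigma1 A U" "measure cantor_measure (U k - V) > 0"
  shows "\<exists>V' N a. unif_sigma1 empty_oracle (\<lambda>_. V') \<and> measure cantor_measure V' < 1 \<and> V \<subseteq> V' \<and>
    k \<le> N \<and> {X. prefix_code X N = a} \<subseteq> U k \<and> {X. prefix_code X N \<noteq> a} \<subseteq> V' \<and>
    (ml_test empty_oracle T \<longrightarrow> (\<exists>n. T n \<subseteq> V'))"
proof -
  obtain Q where Q: "\<And>i m n X. m \<le> n \<Longrightarrow> Q i m (prefix_code X m) \<Longrightarrow> Q i n (prefix_code X n)"
    "\<And>i X. X \<in> U i \<longleftrightarrow> (\<exists>n. Q i n (prefix_code X n))"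
    using U(1) by (rule unif_sigma1E) blast
  have VM: "V \<in> sets cantor_measure" using sets_unif_sigma1[OF V(1)] .
  let ?C = "\<lambda>N a. {X. prefix_code X N = a}"
  \<comment> \<open>\<open>U k\<close> is a countable union of cylinders of length at least k; if
    each of them met the complement of V in a null set, \<open>U k - V\<close> would be
    null.\<close>
  have "\<exists>N a. k \<le> N \<and> Q k N a \<and> measure cantor_measure (?C N a - V) \<noteq> 0"
  proof (rule ccontr)
    assume neg: "\<not> ?thesis"
    have "U k - V \<subseteq> (\<Union>N\<in>{k..}. \<Union>a\<in>{a. Q k N a}. ?C N a - V)"
    proof
      fix X assume X: "X \<in> U k - V"
      then obtain n where "Q k n (prefix_code X n)" using Q(2) by blast
      then have "Q k (max n k) (prefix_code X (max n k))" using Q(1) max.cobounded1 by blast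
      then show "X \<in> (\<Union>N\<in>{k..}. \<Union>a\<in>{a. Q k N a}. ?C N a - V)"
        using X by (intro UN_I[of "max n k"] UN_I[of "prefix_code X (max n k)"]) auto
    qed
    moreover have "(\<Union>N\<in>{k..}. \<Union>a\<in>{a. Q k N a}. ?C N a - V) \<in> null_sets cantor_measure"
    proof (intro null_sets_UN' countableI_type null_setsI)
      fix N a assume "N \<in> {k..}" "a \<in> {a. Q k N a}"
      then show "emeasure cantor_measure (?C N a - V) = 0"
        using neg by (simp add: cantor.emeasure_eq_measure)
      show "?C N a - V \<in> sets cantor_measure" by (rule sets.Diff[OF sets_prefix_code_mem[of "\<lambda>c. c = a" N] VM])
    qed
    ultimately have "U k - V \<in> null_sets cantor_measure"
      using VM sets_unif_sigma1[OF U(1)] by (meson null_sets_subset sets.Diff)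
    then show False using U(2) by (simp add: null_sets_def measure_def)
  qed
  then obtain N a where N: "k \<le> N" "Q k N a" "measure cantor_measure (?C N a - V) \<noteq> 0" by blast
  define V1 where "V1 = V \<union> {X. prefix_code X N \<noteq> a}"
  have V1: "unif_sigma1 empty_oracle (\<lambda>_. V1)"
    unfolding V1_def by (intro unif_sigma1_Un V unif_sigma1_prefix_code_neq)
  have "V1 = UNIV - (?C N a - V)" by (auto simp: V1_def)
  then have "measure cantor_measure V1 = 1 - measure cantor_measure (?C N a - V)"
    using cantor.prob_compl[of "?C N a - V"] VM sets_prefix_code_mem[of "\<lambda>c. c = a" N] by simp
  then have V1lt: "measure cantor_measure V1 < 1" using N(3) by (simp add: zero_less_measure_iff)
  have sub: "?C N a \<subseteq> U k" using N(2) Q(2) by blast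
  show ?thesis
  proof (cases "ml_test empty_oracle T")
    case True
    \<comment> \<open>Level n of T is smaller than the measure left outside V1, so some measure
      remains after its removal.\<close>
    obtain n where n: "(1/2) ^ n < 1 - measure cantor_measure V1"
      using real_arch_pow_inv[of "1 - measure cantor_measure V1" "1/2"] V1lt by auto
    have T: "unif_sigma1 empty_oracle T" "emeasure cantor_measure (T n) \<le> ennreal ((1/2) ^ n)"
      using True by (auto simp: ml_test_def)
    have "measure cantor_measure (T n) \<le> (1/2) ^ n"
      using T(2) by (simp add: cantor.emeasure_eq_measure)
    then have "measure cantor_measure (V1 \<union> T n) < 1"
      using n measure_Un_le[of V1 cantor_measure "T n"] sets_unif_sigma1[OF V1] sets_unif_sigma1[OF T(1)]
      by (smt (verit))
    moreover have "unif_sigma1 empty_oracle (\<lambda>_. V1 \<union> T n)"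
      by (intro unif_sigma1_Un V1 unif_sigma1_const[OF T(1)])
    ultimately show ?thesis
      using N(1) sub by (intro exI[of _ "V1 \<union> T n"] exI[of _ N] exI[of _ a]) (auto simp: V1_def)
  next
    case False
    then show ?thesis
      using N(1) sub V1 V1lt by (intro exI[of _ "V1"] exI[of _ N] exI[of _ a]) (auto simp: V1_def)
  qed
qed

text \<open>If no such V existed, \<open>forcing_step\<close> could be iterated forever. The point
  so determined lies in all levels of U and outside some level of every oracle-free test, against
  lowness.\<close>

lemma low_cover_up_to_null:
  assumes low: "low_for_1_randomness A" and U: "ml_test A U"
  obtains k V where "unif_sigma1 empty_oracle (\<lambda>_. V)" "measure cantor_measure V < 1"
    "measure cantor_measure (U k - V) = 0"
proof (rule ccontr)
  note result = that
  assume neg: "\<not> thesis"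
  have H: "measure cantor_measure (U k - V) > 0"
    if "unif_sigma1 empty_oracle (\<lambda>_. V)" "measure cantor_measure V < 1" for k V
  proof (rule ccontr)
    assume "\<not> ?thesis"
    then have "measure cantor_measure (U k - V) = 0" by (simp add: zero_less_measure_iff)
    then show False using result[OF that] neg by simp
  qed
  have US: "unif_sigma1 A U" using U by (simp add: ml_test_def)
  define ok where "ok V \<longleftrightarrow> unif_sigma1 empty_oracle (\<lambda>_. V) \<and> measure cantor_measure V < 1" for V
  define ext where "ext k V V' \<longleftrightarrow> V \<subseteq> V' \<and> (\<exists>N a. k \<le> N \<and> {X. prefix_code X N = a} \<subseteq> U k \<and>
      {X. prefix_code X N \<noteq> a} \<subseteq> V') \<and> (ml_test empty_oracle (univ_test k) \<longrightarrow> (\<exists>n. univ_test k n \<subseteq> V'))" for k V V'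
  have "\<exists>V. \<forall>k. ok (V k) \<and> ext k (V k) (V (Suc k))"
  proof (rule dependent_nat_choice)
    have "unif_sigma1 empty_oracle (\<lambda>_. {})"
      by (rule unif_sigma1I[where Q = "\<lambda>_ _ _. False"]) (auto intro: sigma1_in_decidable recursive_intros)
    then show "\<exists>V. ok V" unfolding ok_def by (intro exI[of _ "{}"]) simp
    fix V k assume "ok V"
    then have V: "unif_sigma1 empty_oracle (\<lambda>_. V)" "measure cantor_measure V < 1"
      by (simp_all add: ok_def)
    obtain V' N a where "unif_sigma1 empty_oracle (\<lambda>_. V')" "measure cantor_measure V' < 1" "V \<subseteq> V'"
      "k \<le> N" "{X. prefix_code X N = a} \<subseteq> U k" "{X. prefix_code X N \<noteq> a} \<subseteq> V'"
      "ml_test empty_oracle (univ_test k) \<longrightarrow> (\<exists>n. univ_test k n \<subseteq> V')"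
      using forcing_step[OF V US H[OF V], of k "univ_test k"] by (elim exE conjE)
    then show "\<exists>V'. ok V' \<and> ext k V V'"
      unfolding ok_def ext_def by (intro exI[of _ V'] conjI exI[of _ N] exI[of _ a])
  qed
  then obtain V where ok: "\<And>k. ok (V k)" and ext: "\<And>k. ext k (V k) (V (Suc k))" by blast
  have mono: "V i \<subseteq> V j" if "i \<le> j" for i j
    using ext[unfolded ext_def, THEN conjunct1] that by (rule lift_Suc_mono_le)
  have "\<forall>k. \<exists>N a. k \<le> N \<and> {X. prefix_code X N = a} \<subseteq> U k \<and> {X. prefix_code X N \<noteq> a} \<subseteq> V (Suc k)"
    using ext[unfolded ext_def, THEN conjunct2, THEN conjunct1] by (rule allI)
  then obtain N a where N: "\<And>k. k \<le> N k" "\<And>k. {X. prefix_code X (N k) = a k} \<subseteq> U k"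
    "\<And>k. {X. prefix_code X (N k) \<noteq> a k} \<subseteq> V (Suc k)" by metis
  have "\<exists>x. x \<notin> V k" for k
  proof (rule ccontr)
    assume "\<not> ?thesis"
    then have "V k = space cantor_measure" by auto
    then show False using ok[of k] cantor.prob_compl[of "{}"] by (simp add: ok_def)
  qed
  then obtain x where x: "\<And>k. x k \<notin> V k" by metis
  have xa: "prefix_code (x j) (N k) = a k" if "Suc k \<le> j" for j k
  proof (rule ccontr)
    assume "prefix_code (x j) (N k) \<noteq> a k"
    then have "x j \<in> V (Suc k)" using N(3)[of k] by (simp add: subset_eq)
    then show False using x[of j] mono[OF that] by (simp add: subset_eq)
  qed
  \<comment> \<open>From \<open>x (i + 2)\<close> on, all points share the prefix
    \<open>a (Suc i)\<close>, whose length \<open>N (Suc i)\<close> exceeds i; so coordinate i has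
    settled. This is compactness made explicit.\<close>
  define X where "X i = x (i + 2) i" for i
  have Xx: "prefix_code (x j) n = prefix_code X n" if "n < j" for n j
    unfolding prefix_code_eq_iff
  proof (intro allI impI)
    fix i assume "i < n"
    then have "prefix_code (x j) (N (Suc i)) = prefix_code (x (i + 2)) (N (Suc i))" using that xa by simp
    then show "x j i = X i" using N(1)[of "Suc i"] by (simp add: prefix_code_eq_iff X_def)
  qed
  have "X \<in> U k" for k
  proof -
    have "prefix_code X (N k) = a k" using Xx[of "N k" "Suc (k + N k)"] xa[of k "Suc (k + N k)"] by simp
    then show ?thesis using N(2) by blast
  qed
  then have "\<not> random_rel A X" using U by (auto simp: random_rel_def)
  then have "\<not> random_rel empty_oracle X" using low by (auto simp: low_for_1_randomness_def)
  then obtain T where T: "ml_test empty_oracle T" "\<And>n. X \<in> T n" by (auto simp: random_rel_def)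
  then obtain e where e: "T = univ_test e"
    unfolding ml_test_def by (elim conjE unif_sigma1_univ_test) blast
  have "\<exists>n. univ_test e n \<subseteq> V (Suc e)"
    using ext[unfolded ext_def, THEN conjunct2, THEN conjunct2, of e] T(1) unfolding e by simp
  then obtain n where "T n \<subseteq> V (Suc e)" unfolding e by (rule exE)
  then have XV: "X \<in> V (Suc e)" using T(2) by blast
  \<comment> \<open>Membership in an open set is decided by a finite prefix, here of length m. A
    late x shares this prefix with X and would lie in \<open>V (Suc e)\<close>, which it was chosen
    to avoid.\<close>
  obtain Q where Q: "\<And>i Y. Y \<in> V (Suc e) \<longleftrightarrow> (\<exists>n. Q (i :: nat) n (prefix_code Y n))"
    using ok[of "Suc e"] unfolding ok_def by (elim conjE unif_sigma1E) blast
  then obtain m where "Q 0 m (prefix_code X m)" using XV by blast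
  then have "Q 0 m (prefix_code (x (Suc (e + m))) m)" using Xx[of m "Suc (e + m)"] by simp
  then have "x (Suc (e + m)) \<in> V (Suc e)" using Q[of _ 0] by blast
  then show False using mono[of "Suc e" "Suc (e + m)"] x by auto
qed

section \<open>Independent blocks and covers of finite weight\<close>

lemma sum_half_power_le: "finite F \<Longrightarrow> (\<Sum>w\<in>F. (1/2) ^ Suc w) \<le> (1::real)"
proof -
  assume "finite F"
  then obtain n where "F \<subseteq> {..<n}" by (metis finite_nat_iff_bounded)
  then have "(\<Sum>w\<in>F. (1/2) ^ Suc w) \<le> (\<Sum>w<n. (1/2) ^ Suc w :: real)" by (intro sum_mono2) auto
  also have "\<dots> = 1 - (1/2) ^ n" by (induction n) auto
  also have "\<dots> \<le> 1" by simp
  finally show ?thesis .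
qed

text \<open>The blocks \<open>ppair w ` UNIV\<close> are disjoint, so these events are independent for different \<open>w\<close>;
  and they decrease in \<open>m\<close>, which makes the levels of the test nested.\<close>

definition zeros :: "nat \<Rightarrow> nat \<Rightarrow> (nat \<Rightarrow> bool) set" where
  "zeros w m = fixing (ppair w ` {..<m}) (\<lambda>_. False)"

lemma mem_zeros_iff: "X \<in> zeros w m \<longleftrightarrow> (\<forall>i<m. \<not> X (ppair w i))"
  by (auto simp: zeros_def fixing_def)

lemma sets_zeros: "zeros w m \<in> sets cantor_measure"
  and measure_zeros: "measure cantor_measure (zeros w m) = (1/2) ^ m"
proof -
  have "card (ppair w ` {..<m}) = m" by (subst card_image) (auto simp: inj_on_def)
  then show "zeros w m \<in> sets cantor_measure" "measure cantor_measure (zeros w m) = (1/2) ^ m"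
    unfolding zeros_def using fixing_measure[of "ppair w ` {..<m}" "\<lambda>_. False"] by auto
qed

lemma measure_avoiding_zeros:
  assumes "finite F"
  shows "measure cantor_measure (UNIV - (\<Union>w\<in>F. zeros w (g w))) = (\<Prod>w\<in>F. 1 - (1/2) ^ g w)"
proof -
  have "card (ppair w ` {..<m}) = m" for w m by (subst card_image) (auto simp: inj_on_def)
  moreover have "fixing {} (\<lambda>_. False) = UNIV" by (simp add: fixing_def)
  moreover have "measure cantor_measure (fixing {} (\<lambda>_. False) - (\<Union>w\<in>F. fixing (ppair w ` {..<g w}) (\<lambda>_. False)))
    = (1/2) ^ card ({} :: nat set) * (\<Prod>w\<in>F. 1 - (1/2) ^ card (ppair w ` {..<g w}))"
    using assms by (intro measure_fixing_avoiding) (auto simp: disjoint_family_on_def)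
  ultimately show ?thesis by (simp add: zeros_def)
qed

lemma ml_test_zeros:
  assumes W: "sigma1_in A (\<lambda>w. w \<in> W)" and f: "recursive_in A f"
    and bound: "\<And>F. finite F \<Longrightarrow> F \<subseteq> W \<Longrightarrow> (\<Sum>w\<in>F. (1/2) ^ f w) \<le> (1::real)"
  shows "ml_test A (\<lambda>k. \<Union>w\<in>W. zeros w (f w + k))"
  unfolding ml_test_def
proof (intro conjI allI)
  show "unif_sigma1 A (\<lambda>k. \<Union>w\<in>W. zeros w (f w + k))"
  proof (rule unif_sigma1I)
    show "sigma1_in3 A (\<lambda>k n a. \<exists>w. w \<in> W \<and> (\<forall>i<f w + k. ppair w i < n \<and> ppair w i \<notin> set_decode a))"
      by (intro sigma1_intros sigma1_in_comp[OF W] sigma1_in_decidable decidable_in_not decidable_in_set_decode decidable_in_less recursive_intros recursive_in_comp[OF f])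
    fix k X
    show "X \<in> (\<Union>w\<in>W. zeros w (f w + k)) \<longleftrightarrow> (\<exists>n w. w \<in> W \<and>
        (\<forall>i<f w + k. ppair w i < n \<and> ppair w i \<notin> set_decode (prefix_code X n)))"
    proof
      assume "X \<in> (\<Union>w\<in>W. zeros w (f w + k))"
      then obtain w where w: "w \<in> W" "X \<in> zeros w (f w + k)" by blast
      obtain n where "ppair w ` {..<f w + k} \<subseteq> {..<n}"
        using finite_nat_iff_bounded[of "ppair w ` {..<f w + k}"] by auto
      then show "\<exists>n w. w \<in> W \<and> (\<forall>i<f w + k. ppair w i < n \<and> ppair w i \<notin> set_decode (prefix_code X n))"
        using w by (intro exI[of _ n] exI[of _ w]) (auto simp: mem_zeros_iff)
    qed (auto simp: mem_zeros_iff)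
  qed
  fix k
  show "(\<Union>w\<in>W. zeros w (f w + Suc k)) \<subseteq> (\<Union>w\<in>W. zeros w (f w + k))"
    by (auto simp: mem_zeros_iff)
  have "measure cantor_measure (\<Union>w\<in>W. zeros w (f w + k)) \<le> (1/2) ^ k"
  proof (rule measure_UN_le)
    fix F assume "finite F" "F \<subseteq> W"
    then have "(\<Sum>w\<in>F. (1/2) ^ f w) * (1/2) ^ k \<le> 1 * (1/2 :: real) ^ k"
      by (intro mult_right_mono bound) auto
    then show "(\<Sum>w\<in>F. measure cantor_measure (zeros w (f w + k))) \<le> (1/2) ^ k"
      by (simp add: measure_zeros power_add sum_distrib_right)
  qed (rule sets_zeros)
  then show "emeasure cantor_measure (\<Union>w\<in>W. zeros w (f w + k)) \<le> ennreal ((1/2) ^ k)"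
    by (simp add: cantor.emeasure_eq_measure)
qed

text \<open>A number w joins T once its event is seen to lie in V up to a small error. Tolerating
  errors makes T c.e. and lets it contain W although V covers the events only up to null sets. The
  weight of T is finite because independent events of infinite total probability would fill the
  space almost entirely, while V and the errors leave positive measure.\<close>

lemma low_cover:
  assumes low: "low_for_1_randomness A"
    and W: "sigma1_in A (\<lambda>w. w \<in> W)" and f: "recursive_in empty_oracle f"
    and bound: "\<And>F. finite F \<Longrightarrow> F \<subseteq> W \<Longrightarrow> (\<Sum>w\<in>F. (1/2) ^ f w) \<le> (1::real)"
  obtains T and K :: real where "sigma1_in empty_oracle (\<lambda>w. w \<in> T)" "W \<subseteq> T"
    "\<And>F. finite F \<Longrightarrow> F \<subseteq> T \<Longrightarrow> (\<Sum>w\<in>F. (1/2) ^ f w) \<le> K"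
proof -
  let ?\<mu> = "measure cantor_measure"
  have test: "ml_test A (\<lambda>k. \<Union>w\<in>W. zeros w (f w + k))"
    by (rule ml_test_zeros[OF W recursive_in_empty[OF f] bound])
  obtain k V where V: "unif_sigma1 empty_oracle (\<lambda>_. V)" "?\<mu> V < 1"
    and null: "?\<mu> ((\<Union>w\<in>W. zeros w (f w + k)) - V) = 0"
    by (rule low_cover_up_to_null[OF low test])
  have VM: "V \<in> sets cantor_measure" using sets_unif_sigma1[OF V(1)] .
  obtain Q where Q: "decidable_in3 empty_oracle Q" "\<And>i m n X. m \<le> n \<Longrightarrow> Q i m (prefix_code X m) \<Longrightarrow> Q i n (prefix_code X n)"
    "\<And>i X. X \<in> V \<longleftrightarrow> (\<exists>n. Q i n (prefix_code X n))"
    using V(1) by (rule unif_sigma1E) blast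
  \<comment> \<open>The tolerated errors add up to at most \<open>(1/2) ^ c\<close>, so V and the
    errors together have measure below 1.\<close>
  obtain c where c: "(1/2) ^ c < 1 - ?\<mu> V"
    using real_arch_pow_inv[of "1 - ?\<mu> V" "1/2"] V(2) by auto
  \<comment> \<open>Stage s of the event of w minus V: the prefix is not yet seen in V and shows no
    1 in the part of the block below s. The constant sequence V is read at index 0.\<close>
  define C where "C w s a \<longleftrightarrow> \<not> Q 0 s a \<and> (\<forall>i<f w + k. ppair w i < s \<longrightarrow> ppair w i \<notin> set_decode a)"
    for w s a
  define T where "T = {w. \<exists>s. (\<Sum>a<2 ^ s. of_bool (C w s a)) * 2 ^ (Suc w + c) < (2 ^ s :: nat)}"
  let ?D = "\<lambda>w s. {X. C w s (prefix_code X s)}"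
  have D_measure: "?\<mu> (?D w s) = real (\<Sum>a<2 ^ s. of_bool (C w s a)) / 2 ^ s" for w s
  proof -
    have "(\<Sum>a<2 ^ s. of_bool (C w s a) :: nat) = card ({..<2 ^ s} \<inter> {a. C w s a})"
      by (subst sum_of_bool_eq) auto
    also have "{..<2 ^ s} \<inter> {a. C w s a} = {a. a < 2 ^ s \<and> C w s a}" by auto
    finally show ?thesis by (simp add: measure_prefix_code_mem)
  qed
  have T_iff: "w \<in> T \<longleftrightarrow> (\<exists>s. ?\<mu> (?D w s) < (1/2) ^ (Suc w + c))" for w
  proof -
    have "(n * 2 ^ m < (2 ^ s :: nat)) \<longleftrightarrow> real n / 2 ^ s < (1/2) ^ m" for n m s
    proof -
      have "(n * 2 ^ m < (2 ^ s :: nat)) \<longleftrightarrow> real (n * 2 ^ m) < real (2 ^ s)" by (rule of_nat_less_iff[symmetric])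
      also have "\<dots> \<longleftrightarrow> real n / 2 ^ s < (1/2) ^ m" by (simp add: field_simps power_one_over)
      finally show ?thesis .
    qed
    then show ?thesis unfolding T_def D_measure mem_Collect_eq by (intro ex_cong1)
  qed
  have D_INT: "(\<Inter>s. ?D w s) = zeros w (f w + k) - V" for w
  proof (intro set_eqI iffI)
    fix X assume X: "X \<in> (\<Inter>s. ?D w s)"
    have "\<not> X (ppair w i)" if "i < f w + k" for i
    proof -
      have "C w (Suc (ppair w i)) (prefix_code X (Suc (ppair w i)))" using X by blast
      then show ?thesis using that by (simp add: C_def)
    qed
    then show "X \<in> zeros w (f w + k) - V" using X Q(3)[of X 0] by (auto simp: C_def mem_zeros_iff)
  next
    fix X assume "X \<in> zeros w (f w + k) - V"
    then show "X \<in> (\<Inter>s. ?D w s)" using Q(3)[of X 0] by (auto simp: C_def mem_zeros_iff)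
  qed
  have D_dec: "decseq (?D w)" for w
    unfolding decseq_def C_def using Q(2)[of _ _ 0] by (auto dest: less_le_trans)
  have "sigma1_in empty_oracle (\<lambda>w. w \<in> T)"
    unfolding T_def C_def mem_Collect_eq
    by (intro sigma1_in_ex sigma1_in_decidable recursive_intros decidable_in_comp3[OF Q(1)] recursive_in_comp[OF f])
  moreover have "W \<subseteq> T"
  proof
    fix w assume w: "w \<in> W"
    have "(\<lambda>s. ?\<mu> (?D w s)) \<longlonglongrightarrow> ?\<mu> (\<Inter>s. ?D w s)"
      using D_dec sets_prefix_code_mem by (intro cantor.finite_Lim_measure_decseq) auto
    moreover have "?\<mu> (zeros w (f w + k) - V) = 0"
    proof -
      have "?\<mu> (zeros w (f w + k) - V) \<le> ?\<mu> ((\<Union>w\<in>W. zeros w (f w + k)) - V)"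
        using w VM sets_zeros
        by (intro cantor.finite_measure_mono sets.Diff sets.countable_UN') (auto intro: countableI_type)
      then show ?thesis using null measure_nonneg[of cantor_measure] by (metis order_antisym)
    qed
    ultimately have "(\<lambda>s. ?\<mu> (?D w s)) \<longlonglongrightarrow> 0" by (simp add: D_INT)
    then have "\<forall>\<^sub>F s in sequentially. ?\<mu> (?D w s) < (1/2) ^ (Suc w + c)"
      by (rule order_tendstoD) simp
    then show "w \<in> T" unfolding T_iff by (auto simp: eventually_sequentially)
  qed
  \<comment> \<open>The argument of \<open>ln\<close> is the measure left by V and the errors. It
    bounds from below the product of the factors \<open>1 - (1/2) ^ (f w + k)\<close>; taking
    logarithms bounds the sum, and \<open>2 ^ k\<close> undoes the shift by k.\<close>
  moreover have "(\<Sum>w\<in>F. (1/2) ^ f w) \<le> - ln (1 - ?\<mu> V - (1/2) ^ c) * 2 ^ k" if F: "finite F" "F \<subseteq> T" for F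
  proof -
    define \<delta> where "\<delta> = 1 - ?\<mu> V - (1/2) ^ c"
    have \<delta>: "\<delta> > 0" using c by (simp add: \<delta>_def)
    let ?Z = "\<lambda>w. zeros w (f w + k)"
    have small: "?\<mu> (?Z w - V) \<le> (1/2) ^ Suc w * (1/2) ^ c" if "w \<in> F" for w
    proof -
      have "w \<in> T" using that F(2) by (rule subsetD[rotated])
      then obtain s where s: "?\<mu> (?D w s) < (1/2) ^ (Suc w + c)" unfolding T_iff by (rule exE)
      have "?\<mu> (?Z w - V) \<le> ?\<mu> (?D w s)"
        unfolding D_INT[symmetric]
        by (intro cantor.finite_measure_mono INT_lower UNIV_I sets_prefix_code_mem[of "C w s" s])
      also have "\<dots> \<le> (1/2) ^ (Suc w + c)" using s by (rule less_imp_le)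
      finally show ?thesis by (simp only: power_add)
    qed
    have E: "?\<mu> (\<Union>w\<in>F. ?Z w - V) \<le> (1/2) ^ c"
    proof -
      have "?\<mu> (\<Union>w\<in>F. ?Z w - V) \<le> (\<Sum>w\<in>F. ?\<mu> (?Z w - V))"
        by (intro measure_UNION_le F(1) sets.Diff sets_zeros VM)
      also have "\<dots> \<le> (\<Sum>w\<in>F. (1/2) ^ Suc w * (1/2) ^ c)" by (intro sum_mono small)
      also have "\<dots> = (\<Sum>w\<in>F. (1/2) ^ Suc w) * (1/2) ^ c" by (simp only: sum_distrib_right)
      also have "\<dots> \<le> 1 * (1/2) ^ c" by (intro mult_right_mono sum_half_power_le[OF F(1)]) auto
      finally show ?thesis by simp
    qed
    have "?\<mu> (V \<union> (\<Union>w\<in>F. ?Z w - V)) \<le> ?\<mu> V + ?\<mu> (\<Union>w\<in>F. ?Z w - V)"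
      using F VM sets_zeros by (intro measure_Un_le) auto
    also have "V \<union> (\<Union>w\<in>F. ?Z w - V) = V \<union> (\<Union>w\<in>F. ?Z w)" by auto
    finally have "?\<mu> (V \<union> (\<Union>w\<in>F. ?Z w)) \<le> 1 - \<delta>" using E by (simp add: \<delta>_def)
    moreover have "?\<mu> (\<Union>w\<in>F. ?Z w) \<le> ?\<mu> (V \<union> (\<Union>w\<in>F. ?Z w))"
      using F VM sets_zeros by (intro cantor.finite_measure_mono) auto
    moreover have "?\<mu> (UNIV - (\<Union>w\<in>F. ?Z w)) = 1 - ?\<mu> (\<Union>w\<in>F. ?Z w)"
      using cantor.prob_compl[of "\<Union>w\<in>F. ?Z w"] F sets_zeros by auto
    ultimately have "\<delta> \<le> (\<Prod>w\<in>F. 1 - (1/2) ^ (f w + k))"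
      using measure_avoiding_zeros[OF F(1), of "\<lambda>w. f w + k"] by simp
    also have "\<dots> \<le> (\<Prod>w\<in>F. exp (- ((1/2) ^ (f w + k))))"
    proof (intro prod_mono conjI)
      fix w
      show "0 \<le> 1 - (1/2 :: real) ^ (f w + k)" by (simp add: power_le_one)
      show "1 - (1/2 :: real) ^ (f w + k) \<le> exp (- ((1/2) ^ (f w + k)))"
        using exp_ge_add_one_self[of "- ((1/2 :: real) ^ (f w + k))"] by simp
    qed
    also have "\<dots> = exp (- ((\<Sum>w\<in>F. (1/2) ^ f w) * (1/2) ^ k))"
      unfolding sum_distrib_right sum_negf[symmetric] power_add by (rule exp_sum[OF F(1), symmetric])
    finally have "\<delta> \<le> exp (- ((\<Sum>w\<in>F. (1/2) ^ f w) * (1/2) ^ k))" .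
    then have "ln \<delta> \<le> ln (exp (- ((\<Sum>w\<in>F. (1/2) ^ f w) * (1/2) ^ k)))"
      using \<delta> by (subst ln_le_cancel_iff) auto
    then have "(\<Sum>w\<in>F. (1/2) ^ f w) * (1/2) ^ k \<le> - ln \<delta>" unfolding ln_exp by linarith
    then have "(\<Sum>w\<in>F. (1/2) ^ f w) * (1/2) ^ k * 2 ^ k \<le> - ln \<delta> * 2 ^ k"
      by (rule mult_right_mono) simp
    moreover have "x * (1/2) ^ k * 2 ^ k = x" for x :: real by (simp add: power_one_over)
    ultimately show ?thesis by (simp only: \<delta>_def)
  qed
  ultimately show thesis by (rule that)
qed

section \<open>Decidability in a low oracle\<close>

text \<open>If each w failed at some level, none would be left at the largest of these finitely many
  levels. This is the pigeonhole step both for extendible strings and for the candidate strings at a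
  point of the final intersection.\<close>

lemma finite_decreasing_witness:
  assumes "finite H" "\<And>k. \<exists>w\<in>H. D k w" "\<And>k l w. k \<le> l \<Longrightarrow> D l w \<Longrightarrow> D (k :: nat) w"
  shows "\<exists>w\<in>H. \<forall>k. D k w"
proof (rule ccontr)
  assume "\<not> ?thesis"
  then obtain g where g: "\<And>w. w \<in> H \<Longrightarrow> \<not> D (g w) w" by metis
  obtain w where w: "w \<in> H" "D (Max (g ` H)) w" using assms(2) by blast
  moreover have "g w \<le> Max (g ` H)" using assms(1) w(1) by simp
  ultimately show False using g assms(3) by blast
qed

text \<open>Above a level N with the largest number of extendible strings, no extendible string
  branches into two. So B is the only path through its prefix of length N, and a bit of B can be
  read from any string that survives all tests.\<close>

lemma bounded_width_tree_path_pi2: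
  assumes C: "sigma1_in3 empty_oracle C" and path: "\<And>k n. C k (prefix_code B k) n"
    and width: "\<And>k. card {\<tau>. \<tau> < 2 ^ k \<and> (\<forall>n. C k \<tau> n)} \<le> c"
  obtains D where "sigma1_in empty_oracle (\<lambda>z. D (pfst z) (psnd z))"
    "\<And>x. B x \<longleftrightarrow> (\<forall>m. D m x)" "\<And>m n x. m \<le> n \<Longrightarrow> D n x \<Longrightarrow> D m x"
proof -
  \<comment> \<open>The full condition quantifies over all n and is not c.e.; only the tests with n
    up to the length are imposed here, and the missing ones are met at longer extensions.\<close>
  define Good where "Good m \<sigma> \<longleftrightarrow> \<sigma> < 2 ^ m \<and> (\<forall>k\<le>m. \<forall>n\<le>m. C k (restrict_code \<sigma> k) n)" for m \<sigma>
  define E where "E M = {\<tau>. \<tau> < 2 ^ M \<and> (\<forall>m\<ge>M. \<exists>\<sigma>. Good m \<sigma> \<and> restrict_code \<sigma> M = \<tau>)}" for M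
  have Good_restr: "Good m (restrict_code \<sigma> m)" if "Good n \<sigma>" "m \<le> n" for m n \<sigma>
    using that unfolding Good_def by (simp add: restrict_code_less restrict_restrict_code)
  have Good_code: "Good m (prefix_code B m)" for m
    unfolding Good_def by (simp add: prefix_code_less restrict_prefix_code path)
  have finE: "finite (E M)" for M by (simp add: E_def)
  have codeE: "prefix_code B M \<in> E M" for M
    unfolding E_def using Good_code by (auto simp: prefix_code_less intro!: exI restrict_prefix_code)
  have cardE: "card (E M) \<le> c" for M
  proof -
    have "E M \<subseteq> {\<tau>. \<tau> < 2 ^ M \<and> (\<forall>n. C M \<tau> n)}"
    proof (intro subsetI CollectI conjI allI)
      fix \<tau> n assume \<tau>: "\<tau> \<in> E M"
      then show "\<tau> < 2 ^ M" by (simp add: E_def)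
      from \<tau> have "\<exists>\<sigma>. Good (max M n) \<sigma> \<and> restrict_code \<sigma> M = \<tau>" by (simp add: E_def)
      then obtain \<sigma> where "Good (max M n) \<sigma>" "restrict_code \<sigma> M = \<tau>" by (elim exE conjE)
      then show "C M \<tau> n" unfolding Good_def by (metis max.cobounded1 max.cobounded2)
    qed
    then have "card (E M) \<le> card {\<tau>. \<tau> < 2 ^ M \<and> (\<forall>n. C M \<tau> n)}" by (intro card_mono) auto
    also have "\<dots> \<le> c" by (rule width)
    finally show ?thesis .
  qed
  have extend: "\<exists>\<rho>\<in>E M. Pr \<rho>"
    if "\<And>m. m \<ge> M \<Longrightarrow> \<exists>\<sigma>. Good m \<sigma> \<and> Pr (restrict_code \<sigma> M)" for M and Pr :: "nat \<Rightarrow> bool"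
  proof -
    let ?D = "\<lambda>k \<rho>. Pr \<rho> \<and> (\<exists>\<sigma>. Good (M + k) \<sigma> \<and> restrict_code \<sigma> M = \<rho>)"
    have "\<exists>\<rho>\<in>{..<2 ^ M}. \<forall>k. ?D k \<rho>"
    proof (rule finite_decreasing_witness)
      fix k
      obtain \<sigma> where "Good (M + k) \<sigma>" "Pr (restrict_code \<sigma> M)" using \<open>\<And>m. m \<ge> M \<Longrightarrow> _ m\<close>[of "M + k"] by auto
      then show "\<exists>\<rho>\<in>{..<2 ^ M}. ?D k \<rho>"
        by (intro bexI[of _ "restrict_code \<sigma> M"] conjI exI[of _ \<sigma>]) (simp_all add: restrict_code_less)
    next
      fix k l \<rho> assume kl: "k \<le> l" and "?D l \<rho>"
      then obtain \<sigma> where "Pr \<rho>" "Good (M + l) \<sigma>" "restrict_code \<sigma> M = \<rho>" by (elim exE conjE)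
      then show "?D k \<rho>"
        using kl by (intro conjI exI[of _ "restrict_code \<sigma> (M + k)"]) (simp_all add: Good_restr restrict_restrict_code)
    qed simp
    then obtain \<rho> where \<rho>: "\<rho> < 2 ^ M" "\<And>k. ?D k \<rho>" by auto
    have "\<rho> \<in> E M"
      unfolding E_def
    proof (intro CollectI conjI allI impI \<rho>(1))
      fix m assume "M \<le> m"
      then show "\<exists>\<sigma>. Good m \<sigma> \<and> restrict_code \<sigma> M = \<rho>" using \<rho>(2)[of "m - M"] by simp
    qed
    then show ?thesis using \<rho>(2) by blast
  qed
  \<comment> \<open>The counts are bounded by c, so a largest one is attained.\<close>
  obtain N where N: "\<And>M. card (E M) \<le> card (E N)"
    using ex_has_greatest_nat[of "\<lambda>_. True" 0 "\<lambda>M. card (E M)" "Suc c"] cardE by (auto simp: less_Suc_eq_le)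
  \<comment> \<open>Each extendible string at level N has an extendible extension at level M, and
    there are no more of the latter than of the former; so restriction is one to one.\<close>
  have inj: "inj_on (\<lambda>\<tau>. restrict_code \<tau> N) (E M)" if "N \<le> M" for M
  proof (rule eq_card_imp_inj_on[OF finE])
    have "E N \<subseteq> (\<lambda>\<tau>. restrict_code \<tau> N) ` E M"
    proof
      fix \<tau> assume \<tau>: "\<tau> \<in> E N"
      have "\<exists>\<rho>\<in>E M. restrict_code \<rho> N = \<tau>"
      proof (rule extend)
        fix m assume "M \<le> m"
        then have "N \<le> m" using \<open>N \<le> M\<close> by simp
        then obtain \<sigma> where "Good m \<sigma>" "restrict_code \<sigma> N = \<tau>" using \<tau> unfolding E_def by auto
        then show "\<exists>\<sigma>. Good m \<sigma> \<and> restrict_code (restrict_code \<sigma> M) N = \<tau>"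
          using \<open>N \<le> M\<close> by (intro exI[of _ \<sigma>]) (simp add: restrict_restrict_code)
      qed
      then show "\<tau> \<in> (\<lambda>\<tau>. restrict_code \<tau> N) ` E M" by auto
    qed
    then have "card (E N) \<le> card ((\<lambda>\<tau>. restrict_code \<tau> N) ` E M)" using finE by (intro card_mono) auto
    then show "card ((\<lambda>\<tau>. restrict_code \<tau> N) ` E M) = card (E M)"
      using card_image_le[OF finE[of M], of "\<lambda>\<tau>. restrict_code \<tau> N"] N[of M] by simp
  qed
  \<comment> \<open>The length \<open>Suc x + N + m\<close> is enough to contain bit x and the
    prefix of length N. This prefix of B enters as a constant, so no oracle is used.\<close>
  define D where "D m x \<longleftrightarrow> (\<exists>\<sigma><2 ^ (Suc x + N + m). Good (Suc x + N + m) \<sigma> \<and>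
    restrict_code \<sigma> N = prefix_code B N \<and> x \<in> set_decode \<sigma>)" for m x
  have sigD: "sigma1_in empty_oracle (\<lambda>z. D (pfst z) (psnd z))"
    unfolding D_def Good_def
    by (intro sigma1_intros sigma1_in_comp3[OF C] sigma1_in_decidable[OF decidable_in_less] sigma1_in_decidable[OF decidable_in_eq]
        sigma1_in_decidable[OF decidable_in_set_decode] recursive_intros)
  have D_mono: "D m x" if "m \<le> n" "D n x" for m n x
  proof -
    obtain \<sigma> where "Good (Suc x + N + n) \<sigma>" "restrict_code \<sigma> N = prefix_code B N" "x \<in> set_decode \<sigma>"
      using \<open>D n x\<close> unfolding D_def by auto
    then show ?thesis
      unfolding D_def using \<open>m \<le> n\<close>
      by (intro exI[of _ "restrict_code \<sigma> (Suc x + N + m)"]) (simp add: restrict_code_less Good_restr restrict_restrict_code del: power_Suc)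
  qed
  have B_iff: "B x \<longleftrightarrow> (\<forall>m. D m x)" for x
  proof (intro iffI allI)
    fix m assume "B x"
    then show "D m x"
      unfolding D_def
      by (intro exI[of _ "prefix_code B (Suc x + N + m)"]) (simp add: prefix_code_less Good_code restrict_prefix_code del: power_Suc)
  next
    assume D: "\<forall>m. D m x"
    let ?M = "Suc x + N"
    have "\<exists>\<rho>\<in>E ?M. restrict_code \<rho> N = prefix_code B N \<and> x \<in> set_decode \<rho>"
    proof (rule extend)
      fix m assume m: "?M \<le> m"
      have "D (m - ?M) x" using D by blast
      then obtain \<sigma> where "Good (?M + (m - ?M)) \<sigma>" "restrict_code \<sigma> N = prefix_code B N" "x \<in> set_decode \<sigma>"
        unfolding D_def by auto
      then show "\<exists>\<sigma>. Good m \<sigma> \<and> restrict_code (restrict_code \<sigma> ?M) N = prefix_code B N \<and> x \<in> set_decode (restrict_code \<sigma> ?M)"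
        using m by (intro exI[of _ \<sigma>]) (simp add: restrict_restrict_code)
    qed
    then obtain \<rho> where \<rho>: "\<rho> \<in> E ?M" "restrict_code \<rho> N = prefix_code B N" "x \<in> set_decode \<rho>" by auto
    have "\<rho> = prefix_code B ?M"
      using inj_onD[OF inj[of ?M] _ \<rho>(1) codeE[of ?M]] \<rho>(2) by (simp add: restrict_prefix_code)
    then show "B x" using \<rho>(3) by simp
  qed
  show thesis by (rule that[of D]) (fact sigD, fact B_iff, fact D_mono)
qed

section \<open>Bounded request sets\<close>

definition request_weight :: "nat \<Rightarrow> nat" where "request_weight y = pfst (psnd y)"

lemma recursive_in_request_weight [recursive_intros]: "recursive_in A g \<Longrightarrow> recursive_in A (\<lambda>x. request_weight (g x))"
  unfolding request_weight_def by (intro recursive_intros)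

lemma request_weight_le: "request_weight y \<le> y"
  unfolding request_weight_def using pfst_le psnd_le le_trans by blast

text \<open>A number \<open>y = ppair n (ppair q r)\<close> requests weight \<open>2\<^sup>-\<^sup>q\<close> for \<open>n\<close>; the label \<open>r\<close> admits repeated
  requests. The enumeration of the \<open>e\<close>-th c.e. set of requests stops counting before its weight
  exceeds \<open>1\<close>.\<close>

definition request_by :: "nat \<Rightarrow> nat \<Rightarrow> nat \<Rightarrow> bool" where
  "request_by e y s \<longleftrightarrow> y < s \<and> halts_by empty_oracle e y s \<and>
    (\<Sum>v<s. of_bool (halts_by empty_oracle e v s) * 2 ^ (s - request_weight v)) \<le> (2 ^ s :: nat)"

definition request :: "nat \<Rightarrow> nat \<Rightarrow> bool" where
  "request e y \<longleftrightarrow> (\<exists>s. request_by e y s)"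

lemma decidable_in_request_by:
  assumes "recursive_in empty_oracle f" "recursive_in empty_oracle g" "recursive_in empty_oracle h"
  shows "decidable_in empty_oracle (\<lambda>x. request_by (f x) (g x) (h x))"
proof (rule decidable_in_comp3[OF _ assms])
  show "decidable_in3 empty_oracle request_by"
    unfolding request_by_def by (intro recursive_intros)
qed

lemma sigma1_in_request:
  assumes "recursive_in empty_oracle f" "recursive_in empty_oracle g"
  shows "sigma1_in empty_oracle (\<lambda>x. request (f x) (g x))"
proof (rule sigma1_in_comp2[OF _ assms])
  show "sigma1_in empty_oracle (\<lambda>z. request (pfst z) (psnd z))"
    unfolding request_def by (intro sigma1_intros sigma1_in_decidable decidable_in_request_by recursive_intros)
qed

text \<open>Scaling by \<open>2 ^ s\<close> makes the bound on the weight a decidable inequality.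
  The subtraction is exact, since the exponent of v is at most v and hence below s.\<close>

lemma stage_sum_le_iff:
  "(\<Sum>v<s. of_bool (P v) * 2 ^ (s - request_weight v)) \<le> (2 ^ s :: nat) \<longleftrightarrow>
    (\<Sum>v\<in>{v. v < s \<and> P v}. (1/2) ^ request_weight v) \<le> (1 :: real)"
proof -
  have "real (\<Sum>v<s. of_bool (P v) * 2 ^ (s - request_weight v)) = (\<Sum>v<s. if P v then 2 ^ s * (1/2) ^ request_weight v else 0)"
    unfolding of_nat_sum
  proof (intro sum.cong refl)
    fix v assume "v \<in> {..<s}"
    then have "request_weight v \<le> s" using request_weight_le[of v] by simp
    then have "(2 :: real) ^ (s - request_weight v) = 2 ^ s * (1/2) ^ request_weight v" by (simp add: power_diff power_one_over)
    then show "real (of_bool (P v) * 2 ^ (s - request_weight v)) = (if P v then 2 ^ s * (1/2) ^ request_weight v else 0)"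
      by simp
  qed
  also have "\<dots> = (\<Sum>v\<in>{v \<in> {..<s}. P v}. 2 ^ s * (1/2) ^ request_weight v)"
    by (rule sum.inter_filter[symmetric]) simp
  also have "{v \<in> {..<s}. P v} = {v. v < s \<and> P v}" by auto
  also have "(\<Sum>v\<in>{v. v < s \<and> P v}. 2 ^ s * (1/2) ^ request_weight v) = 2 ^ s * (\<Sum>v\<in>{v. v < s \<and> P v}. (1/2 :: real) ^ request_weight v)"
    by (rule sum_distrib_left[symmetric])
  finally have eq: "real (\<Sum>v<s. of_bool (P v) * 2 ^ (s - request_weight v)) =
    2 ^ s * (\<Sum>v\<in>{v. v < s \<and> P v}. (1/2) ^ request_weight v)" .
  have "(\<Sum>v<s. of_bool (P v) * 2 ^ (s - request_weight v)) \<le> (2 ^ s :: nat) \<longleftrightarrow>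
      real (\<Sum>v<s. of_bool (P v) * 2 ^ (s - request_weight v)) \<le> real (2 ^ s)"
    by (rule of_nat_le_iff[symmetric])
  also have "\<dots> \<longleftrightarrow> (\<Sum>v\<in>{v. v < s \<and> P v}. (1/2) ^ request_weight v) \<le> (1 :: real)"
    unfolding eq by simp
  finally show ?thesis .
qed

text \<open>At the latest of the stages that admit the members of F, all of them are
  counted.\<close>

lemma request_sum_le:
  assumes "finite F" "\<And>y. y \<in> F \<Longrightarrow> request e y"
  shows "(\<Sum>y\<in>F. (1/2) ^ request_weight y) \<le> (1 :: real)"
proof (cases "F = {}")
  case False
  obtain g where g: "\<And>y. y \<in> F \<Longrightarrow> request_by e y (g y)"
    using assms(2) unfolding request_def by metis
  have "Max (g ` F) \<in> g ` F" using assms(1) False by (intro Max_in) auto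
  then obtain z where z: "z \<in> F" "Max (g ` F) = g z" by auto
  have max: "g y \<le> g z" if "y \<in> F" for y using assms(1) that by (simp flip: z(2))
  have "F \<subseteq> {v. v < g z \<and> halts_by empty_oracle e v (g z)}"
  proof
    fix y assume y: "y \<in> F"
    have "y < g y" "halts_by empty_oracle e y (g y)" using g[OF y] by (simp_all add: request_by_def)
    then show "y \<in> {v. v < g z \<and> halts_by empty_oracle e v (g z)}"
      using max[OF y] halts_by_mono by auto
  qed
  then have "(\<Sum>y\<in>F. (1/2 :: real) ^ request_weight y) \<le>
      (\<Sum>y\<in>{v. v < g z \<and> halts_by empty_oracle e v (g z)}. (1/2) ^ request_weight y)"
    by (intro sum_mono2) auto
  also have "\<dots> \<le> 1" using g[OF z(1)] unfolding request_by_def stage_sum_le_iff by simp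
  finally show ?thesis .
qed simp

text \<open>A set that respects the bound never triggers the cutoff, so it is enumerated
  completely.\<close>

lemma request_universal:
  assumes "sigma1_in empty_oracle P"
    and "\<And>F. finite F \<Longrightarrow> (\<And>y. y \<in> F \<Longrightarrow> P y) \<Longrightarrow> (\<Sum>y\<in>F. (1/2) ^ request_weight y) \<le> (1 :: real)"
  obtains e where "\<And>y. P y \<longleftrightarrow> request e y"
proof -
  obtain e where e: "\<And>y. P y \<longleftrightarrow> (\<exists>s. halts_by empty_oracle e y s)"
    using sigma1_in_universal[OF assms(1)] by blast
  have "P y \<longleftrightarrow> request e y" for y
  proof
    assume "P y"
    then obtain s where s: "halts_by empty_oracle e y s" using e by blast
    let ?s = "max s (Suc y)"
    have "(\<Sum>y\<in>{v. v < ?s \<and> halts_by empty_oracle e v ?s}. (1/2) ^ request_weight y) \<le> (1 :: real)"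
    proof (rule assms(2))
      show "P v" if "v \<in> {v. v < ?s \<and> halts_by empty_oracle e v ?s}" for v
        using that unfolding e by blast
    qed simp
    then have "request_by e y ?s"
      unfolding request_by_def stage_sum_le_iff using halts_by_mono[OF s] by simp
    then show "request e y" unfolding request_def by blast
  next
    assume "request e y"
    then show "P y" unfolding e request_def request_by_def by blast
  qed
  then show thesis by (rule that)
qed

text \<open>The factor \<open>(1/2) ^ Suc e\<close> merges all request sets into one of total weight
  at most 1. The selector h admits pairs with or without an attached string.\<close>

lemma request_pairs_sum_le:
  assumes F: "finite F" and req: "\<And>w. w \<in> F \<Longrightarrow> request (pfst w) (h w)"
    and inj: "inj_on (\<lambda>w. (pfst w, h w)) F"
  shows "(\<Sum>w\<in>F. (1/2) ^ (Suc (pfst w) + request_weight (h w))) \<le> (1 :: real)"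
proof -
  have inner: "(\<Sum>w\<in>{w \<in> F. pfst w = e}. (1/2) ^ request_weight (h w)) \<le> (1 :: real)" for e
  proof -
    have "inj_on h {w \<in> F. pfst w = e}" using inj by (auto simp: inj_on_def)
    then have "(\<Sum>w\<in>{w \<in> F. pfst w = e}. (1/2 :: real) ^ request_weight (h w)) = (\<Sum>y\<in>h ` {w \<in> F. pfst w = e}. (1/2) ^ request_weight y)"
      by (simp add: sum.reindex)
    also have "\<dots> \<le> 1" using F req by (intro request_sum_le[of _ e]) auto
    finally show ?thesis .
  qed
  have "(\<Sum>w\<in>F. (1/2 :: real) ^ (Suc (pfst w) + request_weight (h w))) =
      (\<Sum>e\<in>pfst ` F. \<Sum>w\<in>{w \<in> F. pfst w = e}. (1/2) ^ (Suc (pfst w) + request_weight (h w)))"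
    using sum.image_gen[OF F, of _ pfst] by blast
  also have "\<dots> = (\<Sum>e\<in>pfst ` F. (1/2) ^ Suc e * (\<Sum>w\<in>{w \<in> F. pfst w = e}. (1/2) ^ request_weight (h w)))"
    unfolding sum_distrib_left by (intro sum.cong refl) (simp add: power_add)
  also have "\<dots> \<le> (\<Sum>e\<in>pfst ` F. (1/2) ^ Suc e * 1)"
    by (intro sum_mono mult_left_mono inner) auto
  also have "\<dots> \<le> 1" using sum_half_power_le[of "pfst ` F"] F by simp
  finally show ?thesis .
qed

section \<open>Counting strings attached to all requests\<close>

text \<open>A factor above 1 would push elements of X beyond its supremum. For X the partial sums of
  the universal weight at n, it turns self-domination into a bound on the width.\<close>

lemma contraction_le_one:
  fixes X :: "real set"
  assumes "bdd_above X" "x0 \<in> X" "x0 > 0" "\<And>x. x \<in> X \<Longrightarrow> a * x \<in> X"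
  shows "a \<le> 1"
proof (rule ccontr)
  assume "\<not> a \<le> 1"
  then have a: "a > 1" by simp
  have le: "x \<le> Sup X" if "x \<in> X" for x using assms(1) that by (rule cSup_upper[rotated])
  have "Sup X \<le> Sup X / a"
  proof (rule cSup_least)
    show "X \<noteq> {}" using assms(2) by auto
    fix x assume "x \<in> X"
    then have "a * x \<le> Sup X" by (intro le assms(4))
    then show "x \<le> Sup X / a" using a by (simp add: field_simps)
  qed
  moreover have "Sup X > 0" using le[OF assms(2)] assms(3) by linarith
  ultimately show False using a by (simp add: field_simps)
qed

lemma low_imp_decidable_pi2:
  assumes low: "low_for_1_randomness A" and B: "decidable_in A B"
  obtains D where "sigma1_in empty_oracle (\<lambda>z. D (pfst z) (psnd z))"
    "\<And>x. B x \<longleftrightarrow> (\<forall>m. D m x)" "\<And>m n x. m \<le> n \<Longrightarrow> D n x \<Longrightarrow> D m x"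
proof -
  let ?y = "\<lambda>w. pfst (psnd w)"
  define f where "f w = Suc (pfst w) + request_weight (?y w)" for w
  have f: "recursive_in empty_oracle f" unfolding f_def by (intro recursive_intros)
  define W where "W = {w. request (pfst w) (?y w) \<and> psnd (psnd w) = prefix_code B (pfst (?y w))}"
  have sigW: "sigma1_in A (\<lambda>w. w \<in> W)"
    unfolding W_def mem_Collect_eq
    by (intro sigma1_in_conj sigma1_in_empty[OF sigma1_in_request] sigma1_in_decidable[OF decidable_in_eq] recursive_in_prefix_code[OF B] recursive_intros)
  \<comment> \<open>The attached prefix is determined by the request, so W weighs no more than the
    requests themselves.\<close>
  have injW: "w = w'" if "w \<in> W" "w' \<in> W" "pfst w = pfst w'" "?y w = ?y w'" for w w'
  proof -
    have "psnd (psnd w) = psnd (psnd w')" using that by (simp add: W_def)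
    then show ?thesis using that(3,4) by (metis ppair_proj)
  qed
  have boundW: "(\<Sum>w\<in>F. (1/2) ^ f w) \<le> (1 :: real)" if "finite F" "F \<subseteq> W" for F
    unfolding f_def
  proof (rule request_pairs_sum_le[OF that(1)])
    show "request (pfst w) (?y w)" if "w \<in> F" for w
      using \<open>F \<subseteq> W\<close> that by (auto simp: W_def)
    show "inj_on (\<lambda>w. (pfst w, ?y w)) F"
      using \<open>F \<subseteq> W\<close> injW by (auto simp: inj_on_def)
  qed
  obtain T K where T: "sigma1_in empty_oracle (\<lambda>w. w \<in> T)" "W \<subseteq> T"
    "\<And>F. finite F \<Longrightarrow> F \<subseteq> T \<Longrightarrow> (\<Sum>w\<in>F. (1/2) ^ f w) \<le> (K :: real)"
    using low_cover[OF low sigW f boundW] by blast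
  obtain c where c: "K \<le> 2 ^ c"
    using real_arch_pow[of 2 K] by (auto intro: less_imp_le)
  \<comment> \<open>Each triple w in T becomes a request for its own n, with w as label; lowering
    the weight of w by \<open>2 ^ c\<close>, a bound for K, keeps the total at most 1.\<close>
  define P where "P v \<longleftrightarrow> psnd (psnd v) \<in> T \<and> pfst v = pfst (?y (psnd (psnd v))) \<and>
    request_weight v = f (psnd (psnd v)) + c \<and> request (pfst (psnd (psnd v))) (?y (psnd (psnd v)))" for v
  have sigP: "sigma1_in empty_oracle P"
    unfolding P_def
    by (intro sigma1_in_conj sigma1_in_comp[OF T(1)] sigma1_in_decidable[OF decidable_in_eq] sigma1_in_request recursive_in_comp[OF f] recursive_intros)
  have boundP: "(\<Sum>v\<in>F. (1/2) ^ request_weight v) \<le> (1 :: real)" if F: "finite F" "\<And>v. v \<in> F \<Longrightarrow> P v" for F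
  proof -
    have inj: "inj_on (\<lambda>v. psnd (psnd v)) F"
    proof (rule inj_onI)
      fix v v' assume v: "v \<in> F" "v' \<in> F" and eq: "psnd (psnd v) = psnd (psnd v')"
      then have "pfst v = pfst v'" "pfst (psnd v) = pfst (psnd v')"
        using F(2)[OF v(1)] F(2)[OF v(2)] by (simp_all add: P_def request_weight_def)
      then show "v = v'" using eq by (metis ppair_proj)
    qed
    have "(\<Sum>v\<in>F. (1/2 :: real) ^ request_weight v) = (\<Sum>v\<in>F. (1/2) ^ f (psnd (psnd v))) * (1/2) ^ c"
      unfolding sum_distrib_right using F(2) by (intro sum.cong refl) (simp add: P_def power_add)
    also have "(\<Sum>v\<in>F. (1/2 :: real) ^ f (psnd (psnd v))) = (\<Sum>w\<in>(\<lambda>v. psnd (psnd v)) ` F. (1/2) ^ f w)"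
      using inj by (simp add: sum.reindex)
    also have "\<dots> * (1/2) ^ c \<le> K * (1/2) ^ c"
      using F by (intro mult_right_mono T(3)) (auto simp: P_def)
    also have "\<dots> \<le> 1" using c by (simp add: power_one_over field_simps)
    finally show ?thesis .
  qed
  obtain d where d: "\<And>v. P v \<longleftrightarrow> request d v" using request_universal[OF sigP boundP] by blast
  \<comment> \<open>A string of length n passes if T attaches it to every request for n. The stage
    inside j makes the premise decidable, so each single test is c.e.\<close>
  define C where "C n \<tau> j \<longleftrightarrow> \<not> (request_by (pfst j) (?y j) (psnd (psnd j)) \<and> pfst (?y j) = n) \<or>
    ppair (pfst j) (ppair (?y j) \<tau>) \<in> T" for n \<tau> j
  have C_iff: "(\<forall>j. C n \<tau> j) \<longleftrightarrow> (\<forall>e y. request e y \<and> pfst y = n \<longrightarrow> ppair e (ppair y \<tau>) \<in> T)" for n \<tau>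
  proof (intro iffI allI impI)
    fix e y assume C: "\<forall>j. C n \<tau> j" and "request e y \<and> pfst y = n"
    then obtain s where "request_by e y s" "pfst y = n" unfolding request_def by blast
    then show "ppair e (ppair y \<tau>) \<in> T" using C[THEN spec, of "ppair e (ppair y s)"] by (simp add: C_def)
  next
    fix j assume "\<forall>e y. request e y \<and> pfst y = n \<longrightarrow> ppair e (ppair y \<tau>) \<in> T"
    then show "C n \<tau> j" unfolding C_def request_def by blast
  qed
  have sigC: "sigma1_in3 empty_oracle C"
    unfolding C_def
    by (intro sigma1_in_disj sigma1_in_comp[OF T(1)] sigma1_in_decidable[OF decidable_in_not] decidable_in_conj decidable_in_request_by recursive_intros)
  have path: "C n (prefix_code B n) j" for n j
  proof -
    have "\<forall>j. C n (prefix_code B n) j"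
      unfolding C_iff using T(2) by (auto simp: W_def subset_eq)
    then show ?thesis by blast
  qed
  have width: "card {\<tau>. \<tau> < 2 ^ n \<and> (\<forall>j. C n \<tau> j)} \<le> 2 ^ (Suc d + c)" for n
  proof -
    define S where "S = {\<tau>. \<tau> < 2 ^ n \<and> (\<forall>j. C n \<tau> j)}"
    have finS: "finite S" unfolding S_def by simp
    define g where "g p = (1/2 :: real) ^ (Suc (pfst p) + request_weight (psnd p))" for p
    define ok where "ok G \<longleftrightarrow> finite G \<and> (\<forall>p\<in>G. request (pfst p) (psnd p) \<and> pfst (psnd p) = n)" for G
    \<comment> \<open>The supremum of X is the total weight at n, the analogue of 2^-K(n). The
      factor a below combines the width with the losses \<open>(1/2) ^ Suc d\<close> for the index
      and \<open>(1/2) ^ c\<close> for P.\<close>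
    define X where "X = {sum g G | G. ok G}"
    define a where "a = (1/2) ^ (Suc d + c) * real (card S)"
    have bdd: "bdd_above X"
    proof (rule bdd_aboveI[of _ 1])
      fix x assume "x \<in> X"
      then obtain G where G: "ok G" and x: "x = sum g G" unfolding X_def by blast
      show "x \<le> 1"
        unfolding x g_def
      proof (rule request_pairs_sum_le)
        show "inj_on (\<lambda>w. (pfst w, psnd w)) G" by (rule inj_onI) (metis Pair_inject ppair_proj)
      qed (use G in \<open>auto simp: ok_def\<close>)
    qed
    \<comment> \<open>A single request for n with exponent 0 provides a positive element of
      X.\<close>
    obtain e where e: "\<And>v. (v = ppair n (ppair 0 0)) \<longleftrightarrow> request e v"
    proof (rule request_universal[of "\<lambda>v. v = ppair n (ppair 0 0)"])
      show "sigma1_in empty_oracle (\<lambda>v. v = ppair n (ppair 0 0))" by (intro sigma1_in_decidable recursive_intros)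
      fix F assume "finite F" "\<And>y. y \<in> F \<Longrightarrow> y = ppair n (ppair 0 0)"
      then have "(\<Sum>y\<in>F. (1/2) ^ request_weight y) \<le> (\<Sum>y\<in>{ppair n (ppair 0 0)}. (1/2 :: real) ^ request_weight y)"
        by (intro sum_mono2) auto
      then show "(\<Sum>y\<in>F. (1/2) ^ request_weight y) \<le> (1 :: real)" by (simp add: request_weight_def)
    qed blast
    define p0 where "p0 = ppair e (ppair n (ppair 0 0))"
    have x0: "sum g {p0} \<in> X"
      unfolding X_def using e by (intro CollectI exI[of _ "{p0}"]) (auto simp: ok_def p0_def)
    txt \<open>The pairs in \<open>T\<close> over \<open>G\<close> and \<open>S\<close> themselves yield requests for \<open>n\<close> in the \<open>d\<close>-th set.\<close>
    have step: "a * x \<in> X" if xX: "x \<in> X" for x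
    proof -
      obtain G where G: "ok G" and x: "x = sum g G" using xX unfolding X_def by blast
      define r where "r = (\<lambda>(p, \<tau>). ppair (pfst p) (ppair (psnd p) \<tau>))"
      define q where "q w = ppair d (ppair n (ppair (f w + c) w))" for w
      have inj: "inj_on (\<lambda>z. q (r z)) (G \<times> S)"
      proof (rule inj_onI)
        fix z z' assume "q (r z) = q (r z')"
        then have "r z = r z'" by (simp add: q_def)
        then have "pfst (fst z) = pfst (fst z')" "psnd (fst z) = psnd (fst z')" "snd z = snd z'"
          by (simp_all add: r_def split_def)
        then show "z = z'" by (metis ppair_proj prod_eqI)
      qed
      have "ok ((\<lambda>z. q (r z)) ` (G \<times> S))"
        unfolding ok_def
      proof (intro conjI ballI)
        show "finite ((\<lambda>z. q (r z)) ` (G \<times> S))" using G finS by (simp add: ok_def)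
        fix v assume "v \<in> (\<lambda>z. q (r z)) ` (G \<times> S)"
        then obtain p \<tau> where p: "p \<in> G" "\<tau> \<in> S" and v: "v = q (r (p, \<tau>))" by auto
        have "\<forall>j. C n \<tau> j" using p(2) by (simp add: S_def)
        then have "r (p, \<tau>) \<in> T" using G p(1) unfolding C_iff ok_def r_def by auto
        then have "P (psnd v)"
          using G p(1) unfolding P_def v q_def by (simp add: request_weight_def r_def ok_def)
        then show "request (pfst v) (psnd v)" using d by (simp add: v q_def)
        show "pfst (psnd v) = n" by (simp add: v q_def)
      qed
      moreover have "sum g ((\<lambda>z. q (r z)) ` (G \<times> S)) = a * x"
      proof -
        have gq: "g (q (r (p, \<tau>))) = (1/2) ^ (Suc d + c) * g p" for p \<tau>
          unfolding g_def q_def r_def f_def by (simp add: request_weight_def power_add)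
        have "sum g ((\<lambda>z. q (r z)) ` (G \<times> S)) = (\<Sum>z\<in>G \<times> S. g (q (r z)))"
          by (simp only: sum.reindex[OF inj] o_def)
        also have "\<dots> = (\<Sum>p\<in>G. \<Sum>\<tau>\<in>S. g (q (r (p, \<tau>))))"
          by (simp only: sum.cartesian_product split_def prod.collapse)
        also have "\<dots> = a * x"
          unfolding gq x a_def sum_distrib_left by (intro sum.cong refl) (simp add: mult_ac)
        finally show ?thesis .
      qed
      ultimately show ?thesis unfolding X_def by force
    qed
    have "a \<le> 1" by (rule contraction_le_one[OF bdd x0 _ step]) (simp_all add: g_def)
    then have "real (card S) \<le> 2 ^ (Suc d + c)" by (simp add: a_def power_one_over field_simps)
    then have "real (card S) \<le> real (2 ^ (Suc d + c))" by simp
    then show ?thesis unfolding S_def of_nat_le_iff .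
  qed
  show thesis
    by (rule bounded_width_tree_path_pi2[OF sigC path width]) (rule that)
qed

section \<open>Covering generalized tests\<close>

text \<open>Here w codes index, length and string. The set is empty if the last entry is too large
  for its length; the cover T may contain such w, so for its members only an upper bound on the
  measure is used.\<close>

definition coded_cylinder :: "nat \<Rightarrow> (nat \<Rightarrow> bool) set" where
  "coded_cylinder w = {X. prefix_code X (pfst (psnd w)) = psnd (psnd w)}"

lemma sets_coded_cylinder: "coded_cylinder w \<in> sets cantor_measure"
  unfolding coded_cylinder_def by (rule sets_prefix_code_mem[of "\<lambda>a. a = psnd (psnd w)"])

lemma measure_coded_cylinder_le: "measure cantor_measure (coded_cylinder w) \<le> (1/2) ^ pfst (psnd w)"
proof -
  have "card {a. a < 2 ^ pfst (psnd w) \<and> a = psnd (psnd w)} \<le> card {psnd (psnd w)}"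
    by (intro card_mono) auto
  then have "real (card {a. a < 2 ^ pfst (psnd w) \<and> a = psnd (psnd w)}) \<le> 1" by simp
  then show ?thesis
    unfolding coded_cylinder_def measure_prefix_code_mem[of "\<lambda>a. a = psnd (psnd w)"]
    by (simp add: power_one_over divide_right_mono)
qed

lemma measure_coded_cylinder:
  assumes "psnd (psnd w) < 2 ^ pfst (psnd w)"
  shows "measure cantor_measure (coded_cylinder w) = (1/2) ^ pfst (psnd w)"
proof -
  have "{a. a < 2 ^ pfst (psnd w) \<and> a = psnd (psnd w)} = {psnd (psnd w)}" using assms by auto
  then show ?thesis
    unfolding coded_cylinder_def measure_prefix_code_mem[of "\<lambda>a. a = psnd (psnd w)"] by (simp add: power_one_over)
qed

lemma infinitely_often_null:
  assumes "\<And>F. finite F \<Longrightarrow> F \<subseteq> T \<Longrightarrow> (\<Sum>w\<in>F. measure cantor_measure (coded_cylinder w)) \<le> K"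
  shows "{X. infinite {w \<in> T. X \<in> coded_cylinder w}} \<in> null_sets cantor_measure"
proof -
  let ?A = "\<lambda>w. if w \<in> T then coded_cylinder w else {}"
  have "summable (\<lambda>w. measure cantor_measure (?A w))"
  proof (rule summableI_nonneg_bounded)
    fix n
    have "(\<Sum>w<n. measure cantor_measure (?A w)) = (\<Sum>w\<in>{w \<in> {..<n}. w \<in> T}. measure cantor_measure (coded_cylinder w))"
      by (subst sum.inter_filter) (auto intro: sum.cong)
    also have "\<dots> \<le> K" by (intro assms) auto
    finally show "(\<Sum>w<n. measure cantor_measure (?A w)) \<le> K" .
  qed simp
  then have "limsup ?A \<in> null_sets cantor_measure"
    by (intro borel_cantelli_limsup1) (auto simp: sets_coded_cylinder cantor.emeasure_eq_measure)
  moreover have "limsup ?A = {X. infinite {w \<in> T. X \<in> coded_cylinder w}}"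
  proof (rule set_eqI)
    fix X
    have "X \<in> limsup ?A \<longleftrightarrow> infinite {w. X \<in> ?A w}"
      unfolding mem_limsup_iff unfolding cofinite_eq_sequentially[symmetric] frequently_cofinite ..
    also have "{w. X \<in> ?A w} = {w \<in> T. X \<in> coded_cylinder w}" by auto
    finally show "X \<in> limsup ?A \<longleftrightarrow> X \<in> {X. infinite {w \<in> T. X \<in> coded_cylinder w}}" by simp
  qed
  ultimately show ?thesis by simp
qed

theorem corollary3p4:
  fixes A :: "nat \<Rightarrow> bool"
  assumes "low_for_1_randomness A"
  shows "low_for_weak_2_random_tests A"
  unfolding low_for_weak_2_random_tests_def
proof (intro allI impI)
  fix V assume V: "gen_ml_test A V"
  let ?n = "\<lambda>w. pfst (psnd w)" and ?a = "\<lambda>w. psnd (psnd w)"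
  have "unif_sigma1 A V" using V by (simp add: gen_ml_test_def)
  then obtain Q where Q: "decidable_in3 A Q" "\<And>i X. X \<in> V i \<longleftrightarrow> (\<exists>n. Q i n (prefix_code X n))"
    by (rule unif_sigma1E) blast
  \<comment> \<open>Minimality makes the cylinders of one index disjoint, and the decidable form of
    Q makes B decidable in A rather than merely c.e.\<close>
  define B where "B w \<longleftrightarrow> ?a w < 2 ^ ?n w \<and> Q (pfst w) (?n w) (?a w) \<and>
    (\<forall>m<?n w. \<not> Q (pfst w) m (restrict_code (?a w) m))" for w
  have decB: "decidable_in A B"
    unfolding B_def by (intro decidable_in_comp3[OF Q(1)] recursive_intros)
  \<comment> \<open>For each index the disjoint cylinders have total measure at most 1; the summand
    \<open>Suc (pfst w)\<close> shares the weight among the indices.\<close>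
  define f where "f w = Suc (pfst w + ?n w)" for w
  have f: "recursive_in empty_oracle f" unfolding f_def by (intro recursive_intros)
  have cyl_disjoint: "w = w'" if B: "B w" "B w'" and i: "pfst w = pfst w'" and X: "X \<in> coded_cylinder w" "X \<in> coded_cylinder w'" for w w' X
  proof -
    have le: "?n w' \<le> ?n w" if "B w" "B w'" "pfst w = pfst w'" "X \<in> coded_cylinder w" "X \<in> coded_cylinder w'" for w w'
    proof (rule ccontr)
      assume *: "\<not> ?n w' \<le> ?n w"
      then have "restrict_code (?a w') (?n w) = ?a w" using that(4,5) restrict_prefix_code[of "?n w" "?n w'" X] by (simp add: coded_cylinder_def)
      then show False using * that(1-3) unfolding B_def by (metis not_le)
    qed
    have "?n w = ?n w'" using le[OF B i X] le[OF B(2,1) i[symmetric] X(2,1)] by simp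
    moreover from this have "?a w = ?a w'" using X by (simp add: coded_cylinder_def)
    ultimately show ?thesis using i by (metis ppair_proj)
  qed
  have bound: "(\<Sum>w\<in>F. (1/2) ^ f w) \<le> (1 :: real)" if F: "finite F" "F \<subseteq> {w. B w}" for F
  proof -
    have inner: "(\<Sum>w\<in>{w \<in> F. pfst w = i}. (1/2) ^ ?n w) \<le> (1 :: real)" for i
    proof -
      have "(\<Sum>w\<in>{w \<in> F. pfst w = i}. (1/2 :: real) ^ ?n w) = (\<Sum>w\<in>{w \<in> F. pfst w = i}. measure cantor_measure (coded_cylinder w))"
        using F(2) by (intro sum.cong refl measure_coded_cylinder[symmetric]) (auto simp: B_def)
      also have "\<dots> = measure cantor_measure (\<Union>w\<in>{w \<in> F. pfst w = i}. coded_cylinder w)"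
      proof (rule cantor.finite_measure_finite_Union[symmetric])
        show "disjoint_family_on coded_cylinder {w \<in> F. pfst w = i}"
          unfolding disjoint_family_on_def
        proof (intro ballI impI)
          fix w w' assume w: "w \<in> {w \<in> F. pfst w = i}" "w' \<in> {w \<in> F. pfst w = i}" "w \<noteq> w'"
          then have "B w" "B w'" "pfst w = pfst w'" using F(2) by auto
          then show "coded_cylinder w \<inter> coded_cylinder w' = {}" using cyl_disjoint w(3) by (meson disjoint_iff)
        qed
      qed (use F sets_coded_cylinder in auto)
      also have "\<dots> \<le> 1" by (rule cantor.prob_le_1)
      finally show ?thesis .
    qed
    have "(\<Sum>w\<in>F. (1/2 :: real) ^ f w) = (\<Sum>i\<in>pfst ` F. \<Sum>w\<in>{w \<in> F. pfst w = i}. (1/2) ^ f w)"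
      by (rule sum.image_gen[OF F(1)])
    also have "\<dots> = (\<Sum>i\<in>pfst ` F. (1/2) ^ Suc i * (\<Sum>w\<in>{w \<in> F. pfst w = i}. (1/2) ^ ?n w))"
      unfolding sum_distrib_left by (intro sum.cong refl) (simp add: f_def power_add)
    also have "\<dots> \<le> (\<Sum>i\<in>pfst ` F. (1/2) ^ Suc i * 1)"
      by (intro sum_mono mult_left_mono inner) auto
    also have "\<dots> \<le> 1" using sum_half_power_le[of "pfst ` F"] F(1) by simp
    finally show ?thesis .
  qed
  have sigB: "sigma1_in A (\<lambda>w. w \<in> {w. B w})" using sigma1_in_decidable[OF decB] by simp
  obtain T K where T: "sigma1_in empty_oracle (\<lambda>w. w \<in> T)" "{w. B w} \<subseteq> T"
    "\<And>F. finite F \<Longrightarrow> F \<subseteq> T \<Longrightarrow> (\<Sum>w\<in>F. (1/2) ^ f w) \<le> (K :: real)"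
    using low_cover[OF assms sigB f bound] by blast
  obtain D where D: "sigma1_in empty_oracle (\<lambda>z. D (pfst z) (psnd z))"
    "\<And>x. B x \<longleftrightarrow> (\<forall>m. D m x)" "\<And>m n x. m \<le> n \<Longrightarrow> D n x \<Longrightarrow> D m x"
    by (rule low_imp_decidable_pi2[OF assms decB]) blast
  define R where "R k i n a \<longleftrightarrow> ppair i (ppair n a) \<in> T \<and> D k (ppair i (ppair n a))" for k i n a
  \<comment> \<open>Level k imposes the conditions of all indices up to k, which makes the sequence
    nested and lets its intersection take care of every \<open>V i\<close>.\<close>
  define G where "G k n a \<longleftrightarrow> (\<forall>i\<le>k. \<exists>m\<le>n. R k i m (restrict_code a m))" for k n a
  define U where "U k = {X. \<exists>n. G k n (prefix_code X n)}" for k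
  have "unif_sigma1 empty_oracle U"
  proof (rule unif_sigma1I)
    show "sigma1_in3 empty_oracle G"
      unfolding G_def R_def by (intro sigma1_intros sigma1_in_comp[OF T(1)] sigma1_in_comp2[OF D(1)] recursive_intros)
  qed (simp add: U_def)
  moreover have nested: "U (Suc k) \<subseteq> U k" for k
  proof
    fix X assume "X \<in> U (Suc k)"
    then obtain n where n: "G (Suc k) n (prefix_code X n)" unfolding U_def by blast
    have "G k n (prefix_code X n)"
      unfolding G_def
    proof (intro allI impI)
      fix i assume "i \<le> k"
      then obtain m where "m \<le> n" "R (Suc k) i m (restrict_code (prefix_code X n) m)"
        using n unfolding G_def by (meson le_SucI)
      then show "\<exists>m\<le>n. R k i m (restrict_code (prefix_code X n) m)"
        unfolding R_def using D(3)[of k "Suc k"] by (intro exI[of _ m]) auto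
    qed
    then show "X \<in> U k" unfolding U_def by blast
  qed
  moreover have sub: "(\<Inter>i. V i) \<subseteq> (\<Inter>i. U i)"
  proof (intro subsetI INT_I)
    fix X k assume X: "X \<in> (\<Inter>i. V i)"
    have "\<exists>n. B (ppair i (ppair n (prefix_code X n)))" for i
    proof -
      have ex: "\<exists>n. Q i n (prefix_code X n)" using X Q(2) by blast
      define n where "n = (LEAST n. Q i n (prefix_code X n))"
      have "Q i n (prefix_code X n)" unfolding n_def using ex by (rule LeastI_ex)
      moreover have "\<not> Q i m (prefix_code X m)" if "m < n" for m
        using that unfolding n_def by (rule not_less_Least)
      ultimately show ?thesis by (intro exI[of _ n]) (simp add: B_def prefix_code_less restrict_prefix_code)
    qed
    then obtain g where g: "\<And>i. B (ppair i (ppair (g i) (prefix_code X (g i))))" by metis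
    have R: "R k i (g i) (prefix_code X (g i))" for i
      unfolding R_def using g[of i] T(2) D(2) by blast
    define n where "n = Max (g ` {..k})"
    have "G k n (prefix_code X n)"
      unfolding G_def
    proof (intro allI impI)
      fix i assume "i \<le> k"
      then have "g i \<le> n" unfolding n_def by (intro Max_ge) auto
      then show "\<exists>m\<le>n. R k i m (restrict_code (prefix_code X n) m)" using R[of i] by (intro exI[of _ "g i"]) (simp add: restrict_prefix_code)
    qed
    then show "X \<in> U k" unfolding U_def by blast
  qed
  moreover have "emeasure cantor_measure (\<Inter>k. U k) = 0"
  proof -
    \<comment> \<open>For a fixed i the index factor in f is the constant
      \<open>(1/2) ^ Suc i\<close>, so the finite weight of T bounds the sum of the
      measures.\<close>
    let ?N = "\<lambda>i. {X. infinite {w \<in> {w \<in> T. pfst w = i}. X \<in> coded_cylinder w}}"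
    have N: "?N i \<in> null_sets cantor_measure" for i
    proof (rule infinitely_often_null)
      fix F assume F: "finite F" "F \<subseteq> {w \<in> T. pfst w = i}"
      have "(\<Sum>w\<in>F. measure cantor_measure (coded_cylinder w)) \<le> (\<Sum>w\<in>F. 2 ^ Suc i * (1/2) ^ f w)"
      proof (rule sum_mono)
        fix w assume "w \<in> F"
        then have "pfst w = i" using F(2) by auto
        then have "2 ^ Suc i * (1/2) ^ f w = (1/2 :: real) ^ ?n w"
          unfolding f_def by (simp add: power_add power_one_over)
        then show "measure cantor_measure (coded_cylinder w) \<le> 2 ^ Suc i * (1/2) ^ f w" using measure_coded_cylinder_le[of w] by simp
      qed
      also have "\<dots> = 2 ^ Suc i * (\<Sum>w\<in>F. (1/2) ^ f w)" by (rule sum_distrib_left[symmetric])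
      also have "\<dots> \<le> 2 ^ Suc i * K" using F by (intro mult_left_mono T(3)) auto
      finally show "(\<Sum>w\<in>F. measure cantor_measure (coded_cylinder w)) \<le> 2 ^ Suc i * K" .
    qed
    have VN: "(\<Inter>i. V i) \<in> null_sets cantor_measure"
    proof (rule null_setsI)
      show "emeasure cantor_measure (\<Inter>i. V i) = 0" using V by (simp add: gen_ml_test_def)
      have "V i \<in> sets cantor_measure" for i by (rule sets_unif_sigma1) fact
      then show "(\<Inter>i. V i) \<in> sets cantor_measure" by (intro sets.countable_INT) auto
    qed
    have "(\<Inter>k. U k) \<subseteq> (\<Inter>i. V i) \<union> (\<Union>i. ?N i)"
    proof
      fix X assume X: "X \<in> (\<Inter>k. U k)"
      show "X \<in> (\<Inter>i. V i) \<union> (\<Union>i. ?N i)"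
      proof (cases "X \<in> (\<Union>i. ?N i)")
        case False
        have "X \<in> V i" for i
        proof -
          let ?H = "{w \<in> {w \<in> T. pfst w = i}. X \<in> coded_cylinder w}"
          have "finite ?H" using False by auto
          moreover have "\<exists>w\<in>?H. D k w" for k
          proof -
            \<comment> \<open>The level must be at least i to test index i, and at least k to yield
              a string in \<open>D k\<close>.\<close>
            have "X \<in> U (max k i)" using X by blast
            then obtain n where "G (max k i) n (prefix_code X n)" unfolding U_def by blast
            then obtain m where "m \<le> n" "R (max k i) i m (restrict_code (prefix_code X n) m)"
              unfolding G_def by (meson max.cobounded2)
            then have R: "R (max k i) i m (prefix_code X m)" by (simp add: restrict_prefix_code)
            then have "D k (ppair i (ppair m (prefix_code X m)))" unfolding R_def using D(3) max.cobounded1 by blast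
            then show ?thesis using R by (intro bexI[of _ "ppair i (ppair m (prefix_code X m))"]) (simp_all add: R_def coded_cylinder_def)
          qed
          ultimately have "\<exists>w\<in>?H. \<forall>k. D k w" by (rule finite_decreasing_witness) (rule D(3))
          then obtain w where w: "pfst w = i" "X \<in> coded_cylinder w" "B w" unfolding D(2) by auto
          then show "X \<in> V i" unfolding Q(2) B_def coded_cylinder_def by (intro exI[of _ "?n w"]) simp
        qed
        then show ?thesis by blast
      qed simp
    qed
    moreover have "(\<Inter>i. V i) \<union> (\<Union>i. ?N i) \<in> null_sets cantor_measure"
      by (intro null_sets.Un VN null_sets_UN N)
    moreover have "(\<Inter>k. U k) \<in> sets cantor_measure"
      using sets_unif_sigma1[OF \<open>unif_sigma1 empty_oracle U\<close>] by (intro sets.countable_INT) auto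
    ultimately have "(\<Inter>k. U k) \<in> null_sets cantor_measure" by (meson null_sets_subset)
    then show ?thesis by (rule null_setsD1)
  qed
  ultimately show "\<exists>U. gen_ml_test empty_oracle U \<and> (\<Inter>i. V i) \<subseteq> (\<Inter>i. U i)"
    unfolding gen_ml_test_def by (intro exI[of _ U]) blast
qed

end
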